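(* Fix a real number $\xi \ge 0$, and let $\boldsymbol{a} = (a_n)_{n \ge 0}$ be a sequence of real numbers. Then the following are equivalent: (a) $\boldsymbol{a}$ is a $\xi$-Stieltjes moment sequence, i.e. there exists a positive measure $\mu$ on $[0,\infty)$ with support contained in $[\xi,\infty)$ such that $a_n = \int x^n \, d\mu(x)$ for all $n \ge 0$. (b) There exist real numbers $c \ge 0$, $g_0 = 0$ and $g_1, g_2, \ldots \ge 0$ such that $$\sum_{n=0}^{\infty} a_n t^n \;=\; \cfrac{c}{1 - \cfrac{\alpha_1 t}{1 - \cfrac{\alpha_2 t}{1 - \cdots}}}$$ holds in the sense of formal power series in $t$, where for all $k \ge 1$ $$\alpha_{2k-1} \;=\; \xi\,(1 + g_{2k-2}) + g_{2k-1}, \qquad \alpha_{2k} \;=\; \frac{g_{2k-1}\, g_{2k}}{1 + g_{2k-2}}.$$ (c) Same as (b), but with the condition $g_0 = 0$ replaced by $g_0 \ge 0$: there exist real numbers $c \ge 0$ and $g_0, g_1, g_2, \ldots \ge 0$ such that the same continued-fraction identity holds in the sense of formal power series in $t$, with $\alpha_{2k-1} = \xi\,(1 + g_{2k-2}) + g_{2k-1}$ and $\alpha_{2k} = \dfrac{g_{2k-1}\, g_{2k}}{1 + g_{2k-2}}$ for all $k \ge 1$.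
   Context: A sequence $\boldsymbol{a} = (a_n)_{n\ge 0}$ of real numbers is a Stieltjes moment sequence if there exists a positive measure $\mu$ on $[0,\infty)$ such that $a_n = \int x^n\, d\mu(x)$ for all $n \ge 0$ (in particular all these integrals are finite); such a $\mu$ is called a representing measure for $\boldsymbol{a}$. For $\xi \ge 0$, a $\xi$-Stieltjes moment sequence is a Stieltjes moment sequence for which there exists a representing measure with support in $[\xi,\infty)$ (other representing measures need not have support in $[\xi,\infty)$). The infinite continued fraction $\cfrac{c}{1 - \cfrac{\alpha_1 t}{1 - \cfrac{\alpha_2 t}{1 - \cdots}}}$ with real coefficients is understood as a formal power series in the indeterminate $t$: it is the limit, in the sense that each coefficient of $t^n$ is eventually constant, as $N\to\infty$ of the finite continued fractions obtained by setting $\alpha_i = 0$ for all $i > N$, each of which is a well-defined element of $\mathbb{R}[[t]]$. The $\alpha_i$ are allowed to be zero. *)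

theory Defs
  imports
    "HOL-Analysis.Analysis"
    "HOL-Computational_Algebra.Formal_Power_Series"
begin

section \<open>Stieltjes moment sequences\<close>

definition measure_support :: "'a::topological_space measure \<Rightarrow> 'a set" where
  "measure_support M =
     {x \<in> space M. \<forall>U. open U \<and> x \<in> U \<longrightarrow> emeasure M (U \<inter> space M) > 0}"

definition Stieltjes_representing_measure :: "real measure \<Rightarrow> (nat \<Rightarrow> real) \<Rightarrow> bool" where
  "Stieltjes_representing_measure M a \<longleftrightarrow>
     sets M = sets (restrict_space borel {0..}) \<and>
     (\<forall>n. integrable M (\<lambda>x. x ^ n) \<and> a n = (\<integral>x. x ^ n \<partial>M))"

definition xi_Stieltjes_moment_sequence :: "real \<Rightarrow> (nat \<Rightarrow> real) \<Rightarrow> bool" where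
  "xi_Stieltjes_moment_sequence \<xi> a \<longleftrightarrow>
     (\<exists>M. Stieltjes_representing_measure M a \<and> measure_support M \<subseteq> {\<xi>..})"

section \<open>Continued fractions as formal power series\<close>

text \<open>
  The denominator \<open>1 - \<alpha>\<^sub>1 t / (1 - \<alpha>\<^sub>2 t / (\<dots> / (1 - \<alpha>\<^sub>N t)))\<close>. The coefficients are
  indexed from 1; the value \<open>\<alpha> 0\<close> is never used.
\<close>
primrec cfrac_denom :: "nat \<Rightarrow> (nat \<Rightarrow> real) \<Rightarrow> real fps" where
  "cfrac_denom 0 \<alpha> = 1"
| "cfrac_denom (Suc N) \<alpha> =
     1 - fps_const (\<alpha> 1) * fps_X / cfrac_denom N (\<lambda>i. \<alpha> (Suc i))"

lemma cfrac_denom_nth_0: "fps_nth (cfrac_denom N \<alpha>) 0 = 1"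
  by (induction N arbitrary: \<alpha>) (simp_all add: fps_divide_unit)

definition finite_cfrac :: "real \<Rightarrow> (nat \<Rightarrow> real) \<Rightarrow> nat \<Rightarrow> real fps" where
  "finite_cfrac c \<alpha> N = fps_const c / cfrac_denom N \<alpha>"

definition has_cfrac_expansion :: "real fps \<Rightarrow> real \<Rightarrow> (nat \<Rightarrow> real) \<Rightarrow> bool" where
  "has_cfrac_expansion F c \<alpha> \<longleftrightarrow>
     (\<forall>n. \<forall>\<^sub>F N in sequentially. fps_nth (finite_cfrac c \<alpha> N) n = fps_nth F n)"

end

theory Submission
  imports
    Defs
    "HOL-Probability.Helly_Selection"
    "HOL-Computational_Algebra.Fundamental_Theorem_Algebra"
begin

text \<open>
  Let \<open>R\<^sub>0 = 1\<close>, \<open>R\<^sub>1 = y\<close> and \<open>R\<^sub>k\<^sub>+\<^sub>1 = y R\<^sub>k - \<alpha>\<^sub>k R\<^sub>k\<^sub>-\<^sub>1\<close>. A power series has the S-fraction with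
  coefficients \<open>\<alpha>\<close> iff the linear functional with moments \<open>a\<^sub>0, 0, a\<^sub>1, 0, a\<^sub>2, \<dots>\<close> annihilates
  all \<open>R\<^sub>k\<close> with \<open>k \<ge> 1\<close>. For a positive symmetric functional such \<open>\<alpha> \<ge> 0\<close> are produced by
  orthogonalization. Conversely, for \<open>\<alpha> \<ge> 0\<close> the polynomials \<open>R\<^sub>k\<close> are orthogonal, Gauss
  quadrature at their zeros represents the functional in low degrees, and Helly's theorem gives
  a measure on the line, whose image under \<open>y \<mapsto> y\<^sup>2 + \<xi>\<close> is the required one.
  Comparing the even contractions (J-fractions) shows that, when \<open>g\<^sub>0 = 0\<close>, the fraction built from
  \<open>g\<close> is the translate by \<open>\<xi>\<close> of the S-fraction with coefficients
  \<open>g\<^sub>2\<^sub>k\<^sub>-\<^sub>1\<close> and \<open>g\<^sub>2\<^sub>k (\<xi> + g\<^sub>2\<^sub>k\<^sub>-\<^sub>1 / (1 + g\<^sub>2\<^sub>k\<^sub>-\<^sub>2))\<close>. The case \<open>g\<^sub>0 > 0\<close> reduces to \<open>g\<^sub>0 = 0\<close>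
  without changing the \<open>\<alpha>\<^sub>k\<close>.
\<close>

section \<open>Moment functionals and continued fractions\<close>

definition moment_functional :: "(nat \<Rightarrow> real) \<Rightarrow> real poly \<Rightarrow> real" where
  "moment_functional s p = (\<Sum>i\<le>degree p. coeff p i * s i)"

text \<open>Lets polynomials of different degrees be summed over one common range, so that linearity
  can be read off coefficientwise.\<close>

lemma moment_functional_bounded_degree:
  assumes "degree p \<le> n"
  shows "moment_functional s p = (\<Sum>i\<le>n. coeff p i * s i)"
  unfolding moment_functional_def
  by (rule sum.mono_neutral_left) (use assms in \<open>auto simp: coeff_eq_0\<close>)

lemma moment_functional_add:
  "moment_functional s (p + q) = moment_functional s p + moment_functional s q"
proof -
  define n where "n = max (degree p) (degree q)"
  have "degree (p + q) \<le> n" "degree p \<le> n" "degree q \<le> n"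
    by (auto simp: n_def degree_add_le_max)
  thus ?thesis
    by (simp add: moment_functional_bounded_degree[where n = n] algebra_simps sum.distrib)
qed

lemma moment_functional_smult:
  "moment_functional s (smult c p) = c * moment_functional s p"
  by (subst (1 2) moment_functional_bounded_degree[where n = "degree p"])
     (auto simp: sum_distrib_left degree_smult_le mult.assoc)

lemma moment_functional_diff:
  "moment_functional s (p - q) = moment_functional s p - moment_functional s q"
  using moment_functional_add[of s "p - q" q] by simp

lemma moment_functional_0 [simp]: "moment_functional s 0 = 0"
  by (simp add: moment_functional_def)

lemma moment_functional_sum:
  "moment_functional s (\<Sum>i\<in>A. f i) = (\<Sum>i\<in>A. moment_functional s (f i))"
  by (induction A rule: infinite_finite_induct) (auto simp: moment_functional_add)

lemma moment_functional_monom [simp]: "moment_functional s (monom c n) = c * s n"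
  by (subst moment_functional_bounded_degree[where n = n])
     (auto simp: degree_monom_le if_distrib[of "\<lambda>x. x * _"] cong: if_cong)

lemma moment_functional_1 [simp]: "moment_functional s 1 = s 0"
  using moment_functional_monom[of s 1 0] by (simp add: monom_0 one_pCons)

lemmas moment_functional_linear =
  moment_functional_add moment_functional_diff moment_functional_smult

text \<open>A polynomial substitution becomes a change of the moment sequence: the new n-th moment
  is the value at \<open>q ^ n\<close>. Reflection, squaring and translation of the variable are all
  handled in this way.\<close>

lemma moment_functional_pcompose:
  "moment_functional s (pcompose p q) = moment_functional (\<lambda>n. moment_functional s (q ^ n)) p"
proof -
  have "pcompose p q = (\<Sum>i\<le>degree p. smult (coeff p i) (q ^ i))"
    by (simp add: pcompose_altdef poly_altdef coeff_map_poly degree_map_poly)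
  thus ?thesis
    by (simp add: moment_functional_sum moment_functional_smult)
       (simp add: moment_functional_def)
qed

text \<open>The moments of the symmetric measure whose image under squaring has moments \<^term>\<open>a\<close>.\<close>

definition symmetrization :: "(nat \<Rightarrow> real) \<Rightarrow> nat \<Rightarrow> real" where
  "symmetrization a n = (if even n then a (n div 2) else 0)"

section \<open>Denominators and convergents of an S-fraction\<close>

fun s_poly :: "(nat \<Rightarrow> real) \<Rightarrow> nat \<Rightarrow> real poly" where
  "s_poly \<alpha> 0 = 1"
| "s_poly \<alpha> (Suc 0) = [:0, 1:]"
| "s_poly \<alpha> (Suc (Suc k)) = [:0, 1:] * s_poly \<alpha> (Suc k) - smult (\<alpha> (Suc k)) (s_poly \<alpha> k)"

text \<open>Denominators of the convergents as polynomials in t. The N-th convergent has denominator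
  \<open>s_denom \<alpha> (Suc N)\<close>; its numerator is, up to the factor c,
  \<open>s_denom\<close> at \<open>N\<close> for the coefficients shifted by one.\<close>

fun s_denom :: "(nat \<Rightarrow> real) \<Rightarrow> nat \<Rightarrow> real fps" where
  "s_denom \<alpha> 0 = 1"
| "s_denom \<alpha> (Suc 0) = 1"
| "s_denom \<alpha> (Suc (Suc k)) = s_denom \<alpha> (Suc k) - fps_const (\<alpha> (Suc k)) * fps_X * s_denom \<alpha> k"

text \<open>The defining recursion appends the last coefficient, while \<open>cfrac_denom\<close>
  peels off the first; this recursion from the left connects the two.\<close>

lemma s_denom_left_rec:
  "s_denom \<alpha> (Suc (Suc k)) =
     s_denom (\<lambda>i. \<alpha> (Suc i)) (Suc k)
       - fps_const (\<alpha> 1) * fps_X * s_denom (\<lambda>i. \<alpha> (Suc (Suc i))) k"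
proof (induction \<alpha> k rule: s_denom.induct)
  case (3 \<alpha> k)
  have "s_denom \<alpha> (Suc (Suc (Suc (Suc k)))) = s_denom \<alpha> (Suc (Suc (Suc k)))
      - fps_const (\<alpha> (Suc (Suc (Suc k)))) * fps_X * s_denom \<alpha> (Suc (Suc k))"
    by (rule s_denom.simps)
  also note "3.IH"(1)
  also note "3.IH"(2)
  finally show ?case
    by (simp only: s_denom.simps(3)[of _ "Suc k"] s_denom.simps(3)[of _ k] algebra_simps)
qed (simp_all add: algebra_simps)

lemma s_denom_nth_0 [simp]: "fps_nth (s_denom \<alpha> k) 0 = 1"
  by (induction \<alpha> k rule: s_denom.induct) auto

text \<open>A factor t costs two steps of the recursion, so the degree in t is at most half the
  index.\<close>

lemma s_denom_nth_eq_0: "k < 2 * j \<Longrightarrow> fps_nth (s_denom \<alpha> k) j = 0"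
  by (induction \<alpha> k arbitrary: j rule: s_denom.induct) (auto simp: mult.assoc)

text \<open>With the inner fraction written as a quotient of two denominators for the shifted
  coefficients, one more level of the fraction is the left recursion.\<close>

lemma cfrac_denom_eq:
  "cfrac_denom N \<alpha> * s_denom (\<lambda>i. \<alpha> (Suc i)) N = s_denom \<alpha> (Suc N)"
proof (induction N arbitrary: \<alpha>)
  case (Suc N)
  define f where "f = cfrac_denom N (\<lambda>i. \<alpha> (Suc i))"
  have f: "f * inverse f = 1"
    by (rule inverse_mult_eq_1') (simp add: f_def cfrac_denom_nth_0)
  have IH: "s_denom (\<lambda>i. \<alpha> (Suc i)) (Suc N) = f * s_denom (\<lambda>i. \<alpha> (Suc (Suc i))) N"
    using Suc.IH[of "\<lambda>i. \<alpha> (Suc i)"] by (simp add: f_def)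
  have "cfrac_denom (Suc N) \<alpha> = 1 - fps_const (\<alpha> 1) * fps_X * inverse f"
    by (simp add: f_def fps_divide_unit cfrac_denom_nth_0)
  hence "cfrac_denom (Suc N) \<alpha> * s_denom (\<lambda>i. \<alpha> (Suc i)) (Suc N) =
      f * s_denom (\<lambda>i. \<alpha> (Suc (Suc i))) N
        - fps_const (\<alpha> 1) * fps_X * (f * inverse f) * s_denom (\<lambda>i. \<alpha> (Suc (Suc i))) N"
    unfolding IH by (simp add: algebra_simps)
  also have "\<dots> = s_denom \<alpha> (Suc (Suc N))"
    unfolding f IH[symmetric] s_denom_left_rec[of \<alpha>] by simp
  finally show ?case .
qed auto

lemma finite_cfrac_mult_s_denom:
  "finite_cfrac c \<alpha> N * s_denom \<alpha> (Suc N) = fps_const c * s_denom (\<lambda>i. \<alpha> (Suc i)) N"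
proof -
  have "cfrac_denom N \<alpha> * inverse (cfrac_denom N \<alpha>) = 1"
    by (rule inverse_mult_eq_1') (simp add: cfrac_denom_nth_0)
  moreover have "finite_cfrac c \<alpha> N = fps_const c * inverse (cfrac_denom N \<alpha>)"
    by (simp add: finite_cfrac_def fps_divide_unit cfrac_denom_nth_0)
  ultimately show ?thesis
    unfolding cfrac_denom_eq[symmetric] by (simp add: algebra_simps)
qed

text \<open>Determinant formula of Euler and Wallis: both sequences solve the same three-term
  recurrence, so each step multiplies their Casoratian by the next coefficient times t.\<close>

lemma s_denom_casorati:
  "s_denom (\<lambda>i. \<alpha> (Suc i)) (Suc N) * s_denom \<alpha> (Suc N)
     - s_denom (\<lambda>i. \<alpha> (Suc i)) N * s_denom \<alpha> (Suc (Suc N))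
   = fps_const (\<Prod>i=1..Suc N. \<alpha> i) * fps_X ^ Suc N"
proof (induction N)
  case (Suc N)
  let ?A = "s_denom (\<lambda>i. \<alpha> (Suc i))" and ?B = "s_denom \<alpha>"
  have "?A (Suc (Suc N)) * ?B (Suc (Suc N)) - ?A (Suc N) * ?B (Suc (Suc (Suc N))) =
      (fps_const (\<alpha> (Suc (Suc N))) * fps_X) *
        (?A (Suc N) * ?B (Suc N) - ?A N * ?B (Suc (Suc N)))"
    unfolding s_denom.simps(3)[of _ "Suc N"] s_denom.simps(3)[of "\<lambda>i. \<alpha> (Suc i)" N]
    by (simp add: algebra_simps del: s_denom.simps)
  also have "\<dots> = (fps_const (\<alpha> (Suc (Suc N))) * fps_X) *
      (fps_const (\<Prod>i=1..Suc N. \<alpha> i) * fps_X ^ Suc N)"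
    unfolding Suc.IH ..
  also have "\<dots> = fps_const (\<Prod>i=1..Suc (Suc N). \<alpha> i) * fps_X ^ Suc (Suc N)"
    by (simp add: algebra_simps flip: fps_const_mult)
  finally show ?case .
qed simp

text \<open>By the determinant formula, consecutive convergents differ by a multiple of t^(N+1)
  divided by a product of denominators, which has constant term 1.\<close>

lemma finite_cfrac_nth_Suc:
  assumes "n \<le> N"
  shows "fps_nth (finite_cfrac c \<alpha> (Suc N)) n = fps_nth (finite_cfrac c \<alpha> N) n"
proof -
  let ?A = "s_denom (\<lambda>i. \<alpha> (Suc i))" and ?B = "s_denom \<alpha>"
  define u where "u = ?B (Suc N) * ?B (Suc (Suc N))"
  define d where "d = finite_cfrac c \<alpha> (Suc N) - finite_cfrac c \<alpha> N"
  have "d * u = (finite_cfrac c \<alpha> (Suc N) * ?B (Suc (Suc N))) * ?B (Suc N)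
      - (finite_cfrac c \<alpha> N * ?B (Suc N)) * ?B (Suc (Suc N))"
    by (simp add: d_def u_def algebra_simps del: s_denom.simps)
  also have "\<dots> = fps_const c * (?A (Suc N) * ?B (Suc N) - ?A N * ?B (Suc (Suc N)))"
    unfolding finite_cfrac_mult_s_denom by (simp add: algebra_simps del: s_denom.simps)
  finally have *: "d * u = fps_X ^ Suc N * fps_const (c * (\<Prod>i=1..Suc N. \<alpha> i))"
    unfolding s_denom_casorati by (simp add: mult_ac flip: fps_const_mult)
  have "u * inverse u = 1"
    by (rule inverse_mult_eq_1') (simp add: u_def del: s_denom.simps)
  hence "d = d * u * inverse u"
    by (simp add: mult.assoc)
  hence "d = fps_X ^ Suc N * (fps_const (c * (\<Prod>i=1..Suc N. \<alpha> i)) * inverse u)"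
    unfolding * by (simp add: mult.assoc)
  hence "fps_nth d n = 0"
    using assms by (simp add: fps_X_power_mult_nth del: power_Suc)
  thus ?thesis
    by (simp add: d_def)
qed

lemma finite_cfrac_nth_stable:
  assumes "n \<le> N"
  shows "fps_nth (finite_cfrac c \<alpha> N) n = fps_nth (finite_cfrac c \<alpha> n) n"
  using assms by (induction N rule: dec_induct) (auto simp: finite_cfrac_nth_Suc)

text \<open>Coefficient n is constant from the n-th convergent on, so its eventual value is the one
  at \<open>N = n\<close>.\<close>

lemma has_cfrac_expansion_iff:
  "has_cfrac_expansion F c \<alpha> \<longleftrightarrow> (\<forall>n. fps_nth F n = fps_nth (finite_cfrac c \<alpha> n) n)"
proof -
  have "(\<forall>\<^sub>F N in sequentially. fps_nth (finite_cfrac c \<alpha> N) n = fps_nth F n) \<longleftrightarrow>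
      fps_nth F n = fps_nth (finite_cfrac c \<alpha> n) n" for n
  proof
    assume "\<forall>\<^sub>F N in sequentially. fps_nth (finite_cfrac c \<alpha> N) n = fps_nth F n"
    then obtain N where "\<And>k. k \<ge> N \<Longrightarrow> fps_nth (finite_cfrac c \<alpha> k) n = fps_nth F n"
      by (auto simp: eventually_sequentially)
    from this[of "max n N"] finite_cfrac_nth_stable[of n "max n N" c \<alpha>]
    show "fps_nth F n = fps_nth (finite_cfrac c \<alpha> n) n" by simp
  next
    assume F: "fps_nth F n = fps_nth (finite_cfrac c \<alpha> n) n"
    show "\<forall>\<^sub>F N in sequentially. fps_nth (finite_cfrac c \<alpha> N) n = fps_nth F n"
      using eventually_ge_at_top[of n] by eventually_elim (metis F finite_cfrac_nth_stable)
  qed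
  thus ?thesis
    by (simp add: has_cfrac_expansion_def)
qed

lemma degree_s_poly_le: "degree (s_poly \<alpha> k) \<le> k"
proof (induction \<alpha> k rule: s_poly.induct)
  case (3 \<alpha> k)
  show ?case
    unfolding s_poly.simps
  proof (rule degree_diff_le)
    show "degree ([:0, 1:] * s_poly \<alpha> (Suc k)) \<le> Suc (Suc k)"
      using 3 degree_mult_le[of "[:0, 1:]" "s_poly \<alpha> (Suc k)"] by simp
    show "degree (smult (\<alpha> (Suc k)) (s_poly \<alpha> k)) \<le> Suc (Suc k)"
      using 3 degree_smult_le[of "\<alpha> (Suc k)" "s_poly \<alpha> k"] by simp
  qed
qed auto

text \<open>\<^const>\<open>s_denom\<close> is the reversal of \<^const>\<open>s_poly\<close> with \<open>t\<close> in place of the squared variable.\<close>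

lemma coeff_s_poly: "2 * j \<le> k \<Longrightarrow> coeff (s_poly \<alpha> k) (k - 2 * j) = fps_nth (s_denom \<alpha> k) j"
proof (induction \<alpha> k arbitrary: j rule: s_poly.induct)
  case (3 \<alpha> k)
  have 1: "coeff ([:0, 1:] * s_poly \<alpha> (Suc k)) (Suc (Suc k) - 2 * j) = fps_nth (s_denom \<alpha> (Suc k)) j"
  proof (cases "2 * j \<le> Suc k")
    case True
    thus ?thesis using "3.IH"(1)[OF True] by (simp add: Suc_diff_le)
  next
    case False
    \<comment> \<open>The induction hypothesis is out of range only at the constant term, which
      vanishes for a multiple of the variable.\<close>
    with "3.prems" have "Suc (Suc k) - 2 * j = 0" by simp
    thus ?thesis using False by (simp add: s_denom_nth_eq_0)
  qed
  show ?case
  proof (cases j)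
    case 0
    have "coeff (s_poly \<alpha> k) (Suc (Suc k)) = 0"
      by (rule coeff_eq_0) (use degree_s_poly_le[of \<alpha> k] in simp)
    thus ?thesis using 1 0 by simp
  next
    case (Suc i)
    thus ?thesis using 1 "3.IH"(2)[of i] "3.prems" by (simp add: mult.assoc)
  qed
next
  case (2 \<alpha>)
  hence "j = 0" by simp
  thus ?case by simp
qed auto

lemma degree_s_poly [simp]: "degree (s_poly \<alpha> k) = k"
  and lead_coeff_s_poly [simp]: "coeff (s_poly \<alpha> k) k = 1"
proof -
  show *: "coeff (s_poly \<alpha> k) k = 1"
    using coeff_s_poly[of 0 k \<alpha>] by simp
  show "degree (s_poly \<alpha> k) = k"
    using degree_s_poly_le[of \<alpha> k] le_degree[of "s_poly \<alpha> k" k] * by simp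
qed

lemma s_poly_reflect: "pcompose (s_poly \<alpha> k) [:0, -1:] = smult ((-1) ^ k) (s_poly \<alpha> k)"
  by (induction \<alpha> k rule: s_poly.induct)
     (simp_all add: pcompose_1 pcompose_pCons pcompose_diff pcompose_smult smult_diff_right mult.commute)

text \<open>Vanishing odd moments make the functional invariant under y -> -y; on an odd polynomial
  its value is then its own negative.\<close>

lemma moment_functional_reflect_odd:
  assumes "\<And>n. odd n \<Longrightarrow> s n = 0" and "pcompose p [:0, -1:] = - p"
  shows "moment_functional s p = 0"
proof -
  have "[:0, -1:] ^ n = monom ((-1 :: real) ^ n) n" for n
    by (induction n) (simp_all add: monom_Suc monom_0 one_pCons smult_monom)
  hence "(\<lambda>n. moment_functional s ([:0, -1:] ^ n)) = s"
    using assms(1) by (auto simp: fun_eq_iff uminus_power_if)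
  hence "moment_functional s (pcompose p [:0, -1:]) = moment_functional s p"
    by (simp add: moment_functional_pcompose)
  moreover have "moment_functional s (- p) = - moment_functional s p"
    using moment_functional_smult[of s "-1" p] by simp
  ultimately show ?thesis
    using assms(2) by simp
qed

lemma moment_functional_s_poly_odd:
  assumes "\<And>n. odd n \<Longrightarrow> s n = 0" and "odd k"
  shows "moment_functional s (s_poly \<alpha> k) = 0"
  by (rule moment_functional_reflect_odd) (use assms in \<open>simp_all add: s_poly_reflect\<close>)

text \<open>Only even powers contribute, and reversing the coefficients of \<open>s_poly\<close>
  turns the sum into a Cauchy product.\<close>

lemma moment_functional_s_poly_even:
  "moment_functional (symmetrization a) (s_poly \<alpha> (2 * k)) = fps_nth (Abs_fps a * s_denom \<alpha> (2 * k)) k"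
proof -
  have "moment_functional (symmetrization a) (s_poly \<alpha> (2 * k)) =
      (\<Sum>i\<in>(\<lambda>j. 2 * j) ` {..k}. coeff (s_poly \<alpha> (2 * k)) i * symmetrization a i)"
    unfolding moment_functional_def degree_s_poly
  proof (rule sum.mono_neutral_right)
    show "\<forall>i\<in>{..2 * k} - (\<lambda>j. 2 * j) ` {..k}. coeff (s_poly \<alpha> (2 * k)) i * symmetrization a i = 0"
      by (auto simp: symmetrization_def elim!: evenE)
  qed auto
  also have "\<dots> = (\<Sum>j\<le>k. coeff (s_poly \<alpha> (2 * k)) (2 * j) * a j)"
    by (subst sum.reindex) (auto simp: inj_on_def symmetrization_def)
  also have "\<dots> = (\<Sum>j\<le>k. a j * fps_nth (s_denom \<alpha> (2 * k)) (k - j))"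
  proof (rule sum.cong)
    fix j assume "j \<in> {..k}"
    thus "coeff (s_poly \<alpha> (2 * k)) (2 * j) * a j = a j * fps_nth (s_denom \<alpha> (2 * k)) (k - j)"
      using coeff_s_poly[of "k - j" "2 * k" \<alpha>] by (simp add: algebra_simps)
  qed simp
  finally show ?thesis
    by (simp add: fps_mult_nth atMost_atLeast0)
qed

text \<open>The denominators have constant term 1, so the k-th value is \<open>a k\<close> plus a
  combination of earlier moments: a unitriangular system.\<close>

lemma moment_functional_s_poly_even_unique:
  assumes "\<And>k. moment_functional (symmetrization a) (s_poly \<alpha> (2 * k)) =
                moment_functional (symmetrization b) (s_poly \<alpha> (2 * k))"
  shows "a = b"
proof
  fix n
  show "a n = b n"
  proof (induction n rule: less_induct)
    case (less n)
    have *: "fps_nth (Abs_fps f * s_denom \<alpha> (2 * n)) n =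
        f n + (\<Sum>i<n. f i * fps_nth (s_denom \<alpha> (2 * n)) (n - i))" for f
      by (simp add: fps_mult_nth atMost_atLeast0[symmetric] lessThan_Suc_atMost[symmetric])
    have "(\<Sum>i<n. a i * fps_nth (s_denom \<alpha> (2 * n)) (n - i)) =
        (\<Sum>i<n. b i * fps_nth (s_denom \<alpha> (2 * n)) (n - i))"
      using less by simp
    thus ?case
      using assms[of n] by (simp add: moment_functional_s_poly_even *)
  qed
qed

lemma has_cfrac_expansion_imp_s_poly:
  assumes "has_cfrac_expansion (Abs_fps a) c \<alpha>"
  shows "moment_functional (symmetrization a) (s_poly \<alpha> (2 * k)) = (if k = 0 then c else 0)"
proof (cases k)
  case 0
  thus ?thesis
    using assms by (auto simp: has_cfrac_expansion_iff finite_cfrac_def symmetrization_def)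
next
  case (Suc m)
  \<comment> \<open>The convergent with denominator of index 2k has numerator of index 2k - 1, hence
    of degree below k. The coefficient of t^k in series times denominator is therefore 0.\<close>
  define N where "N = Suc (2 * m)"
  have a: "a i = fps_nth (finite_cfrac c \<alpha> N) i" if "i \<le> N" for i
    using assms finite_cfrac_nth_stable[OF that, of c \<alpha>] by (auto simp: has_cfrac_expansion_iff)
  have "fps_nth (Abs_fps a * s_denom \<alpha> (Suc N)) k =
      fps_nth (finite_cfrac c \<alpha> N * s_denom \<alpha> (Suc N)) k"
    unfolding fps_mult_nth by (rule sum.cong) (auto simp: a N_def Suc)
  also have "\<dots> = 0"
    unfolding finite_cfrac_mult_s_denom by (simp add: s_denom_nth_eq_0 N_def Suc)
  finally show ?thesis
    using moment_functional_s_poly_even[of a \<alpha> k] by (simp add: N_def Suc del: s_denom.simps s_poly.simps)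
qed

text \<open>For the converse, the fraction always expands to some series b; its values agree with
  those of a, and the values determine the moments.\<close>

theorem has_cfrac_expansion_iff_s_poly:
  "has_cfrac_expansion (Abs_fps a) c \<alpha> \<longleftrightarrow>
     (\<forall>k. moment_functional (symmetrization a) (s_poly \<alpha> (2 * k)) = (if k = 0 then c else 0))"
    (is "_ \<longleftrightarrow> ?R")
proof
  assume R: ?R
  define b where "b n = fps_nth (finite_cfrac c \<alpha> n) n" for n
  have "has_cfrac_expansion (Abs_fps b) c \<alpha>"
    by (simp add: has_cfrac_expansion_iff b_def)
  moreover from has_cfrac_expansion_imp_s_poly[OF this] R have "a = b"
    by (intro moment_functional_s_poly_even_unique[of _ \<alpha>]) simp
  ultimately show "has_cfrac_expansion (Abs_fps a) c \<alpha>" by simp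
qed (auto simp: has_cfrac_expansion_imp_s_poly)

section \<open>Even contraction to a J-fraction, and translation\<close>

fun j_poly :: "(nat \<Rightarrow> real) \<Rightarrow> (nat \<Rightarrow> real) \<Rightarrow> nat \<Rightarrow> real poly" where
  "j_poly \<gamma> \<beta> 0 = 1"
| "j_poly \<gamma> \<beta> (Suc 0) = [:- \<gamma> 0, 1:]"
| "j_poly \<gamma> \<beta> (Suc (Suc k)) =
     [:- \<gamma> (Suc k), 1:] * j_poly \<gamma> \<beta> (Suc k) - smult (\<beta> (Suc k)) (j_poly \<gamma> \<beta> k)"

text \<open>Two steps of the recurrence, with the odd-indexed polynomial eliminated, give a
  recurrence in y^2 for the even-indexed ones.\<close>

lemma s_poly_even:
  assumes "\<gamma> 0 = \<alpha> 1" "\<And>k. k \<ge> 1 \<Longrightarrow> \<gamma> k = \<alpha> (2 * k) + \<alpha> (2 * k + 1)"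
    and "\<And>k. k \<ge> 1 \<Longrightarrow> \<beta> k = \<alpha> (2 * k - 1) * \<alpha> (2 * k)"
  shows "s_poly \<alpha> (2 * k) = pcompose (j_poly \<gamma> \<beta> k) [:0, 0, 1:]"
  using assms
proof (induction \<gamma> \<beta> k rule: j_poly.induct)
  case (2 \<gamma> \<beta>)
  thus ?case by (simp add: numeral_2_eq_2 pcompose_pCons)
next
  case (3 \<gamma> \<beta> k)
  define y where "y = [:0, 1 :: real:]"
  define a b c where "a = s_poly \<alpha> (2 * k)" and "b = s_poly \<alpha> (2 * k + 1)" and "c = s_poly \<alpha> (2 * k + 2)"
  have c: "c = y * b - [:\<alpha> (2 * k + 1):] * a"
    by (simp add: a_def b_def c_def y_def)
  have d: "s_poly \<alpha> (2 * k + 3) = y * c - [:\<alpha> (2 * k + 2):] * b"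
    by (simp add: b_def c_def y_def eval_nat_numeral)
  have "s_poly \<alpha> (2 * k + 4) = y * s_poly \<alpha> (2 * k + 3) - [:\<alpha> (2 * k + 3):] * c"
    by (simp add: c_def y_def eval_nat_numeral)
  also have "\<dots> = y * y * c - [:\<alpha> (2 * k + 2):] * (y * b) - [:\<alpha> (2 * k + 3):] * c"
    unfolding d by (simp add: algebra_simps)
  also have "y * b = c + [:\<alpha> (2 * k + 1):] * a"
    unfolding c by simp
  also have "y * y * c - [:\<alpha> (2 * k + 2):] * (c + [:\<alpha> (2 * k + 1):] * a) - [:\<alpha> (2 * k + 3):] * c =
      (y * y - [:\<alpha> (2 * k + 2):] - [:\<alpha> (2 * k + 3):]) * c
        - ([:\<alpha> (2 * k + 1):] * [:\<alpha> (2 * k + 2):]) * a"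
    by (simp only: algebra_simps)
  also have "[:\<alpha> (2 * k + 1):] * [:\<alpha> (2 * k + 2):] = [:\<beta> (Suc k):]"
    using 3(5)[of "Suc k"] by simp
  also have "y * y - [:\<alpha> (2 * k + 2):] - [:\<alpha> (2 * k + 3):] = [:- \<gamma> (Suc k), 0, 1:]"
    using 3(4)[of "Suc k"] by (simp add: y_def numeral_3_eq_3)
  finally have "s_poly \<alpha> (2 * k + 4) = [:- \<gamma> (Suc k), 0, 1:] * c - [:\<beta> (Suc k):] * a" .
  moreover have "c = pcompose (j_poly \<gamma> \<beta> (Suc k)) [:0, 0, 1:]" "a = pcompose (j_poly \<gamma> \<beta> k) [:0, 0, 1:]"
    using 3 by (simp_all add: c_def a_def)
  ultimately show ?case
    by (simp add: pcompose_diff pcompose_mult pcompose_smult pcompose_pCons eval_nat_numeral)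
qed (auto simp: pcompose_1)

text \<open>Translating the variable changes only the diagonal coefficients of a J-fraction; this is
  why S-fractions are contracted before they are translated.\<close>

lemma j_poly_shift:
  "j_poly (\<lambda>k. \<gamma> k + \<xi>) \<beta> k = pcompose (j_poly \<gamma> \<beta> k) [:-\<xi>, 1:]"
  by (induction \<gamma> \<beta> k rule: j_poly.induct)
     (simp_all add: pcompose_diff pcompose_mult pcompose_smult pcompose_pCons pcompose_1
        smult_diff_left)

lemma moment_functional_symmetrization_square:
  "moment_functional (symmetrization a) (pcompose p [:0, 0, 1:]) = moment_functional a p"
proof -
  have "[:0, 0, 1:] ^ n = monom (1::real) (2 * n)" for n
    by (simp add: monom_altdef power_mult power2_eq_square)
  thus ?thesis
    by (simp add: moment_functional_pcompose symmetrization_def)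
qed

lemma has_cfrac_expansion_iff_j_poly:
  assumes "\<gamma> 0 = \<alpha> 1" "\<And>k. k \<ge> 1 \<Longrightarrow> \<gamma> k = \<alpha> (2 * k) + \<alpha> (2 * k + 1)"
    and "\<And>k. k \<ge> 1 \<Longrightarrow> \<beta> k = \<alpha> (2 * k - 1) * \<alpha> (2 * k)"
  shows "has_cfrac_expansion (Abs_fps a) c \<alpha> \<longleftrightarrow>
           (\<forall>k. moment_functional a (j_poly \<gamma> \<beta> k) = (if k = 0 then c else 0))"
  using s_poly_even[of \<gamma> \<alpha> \<beta>, OF assms]
  by (simp add: has_cfrac_expansion_iff_s_poly moment_functional_symmetrization_square)

text \<open>The hypotheses say that the two contractions have equal \<beta> and diagonal
  coefficients differing by \<xi>, so their denominators are translates of each other.\<close>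

theorem has_cfrac_expansion_shift:
  assumes "\<alpha> 1 = \<alpha>' 1 + \<xi>"
    and "\<And>k. k \<ge> 1 \<Longrightarrow> \<alpha> (2 * k) + \<alpha> (2 * k + 1) = \<alpha>' (2 * k) + \<alpha>' (2 * k + 1) + \<xi>"
    and "\<And>k. k \<ge> 1 \<Longrightarrow> \<alpha> (2 * k - 1) * \<alpha> (2 * k) = \<alpha>' (2 * k - 1) * \<alpha>' (2 * k)"
  shows "has_cfrac_expansion (Abs_fps a) c \<alpha> \<longleftrightarrow>
           has_cfrac_expansion (Abs_fps (\<lambda>n. moment_functional a ([:-\<xi>, 1:] ^ n))) c \<alpha>'"
proof -
  define \<gamma> where "\<gamma> k = (if k = 0 then \<alpha>' 1 else \<alpha>' (2 * k) + \<alpha>' (2 * k + 1))" for k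
  define \<beta> where "\<beta> k = \<alpha>' (2 * k - 1) * \<alpha>' (2 * k)" for k
  have "has_cfrac_expansion (Abs_fps a) c \<alpha> \<longleftrightarrow>
      (\<forall>k. moment_functional a (j_poly (\<lambda>k. \<gamma> k + \<xi>) \<beta> k) = (if k = 0 then c else 0))"
    by (rule has_cfrac_expansion_iff_j_poly) (use assms in \<open>auto simp: \<gamma>_def \<beta>_def\<close>)
  also have "\<dots> \<longleftrightarrow> (\<forall>k. moment_functional (\<lambda>n. moment_functional a ([:-\<xi>, 1:] ^ n)) (j_poly \<gamma> \<beta> k)
      = (if k = 0 then c else 0))"
    unfolding j_poly_shift moment_functional_pcompose ..
  also have "\<dots> \<longleftrightarrow> has_cfrac_expansion (Abs_fps (\<lambda>n. moment_functional a ([:-\<xi>, 1:] ^ n))) c \<alpha>'"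
    by (rule has_cfrac_expansion_iff_j_poly[symmetric]) (auto simp: \<gamma>_def \<beta>_def)
  finally show ?thesis .
qed

section \<open>Gauss quadrature and orthogonalization\<close>

text \<open>The recurrence solved for the product with the variable; the factor 0 at
  \<open>k = 0\<close> covers the truncated \<open>k - 1\<close>.\<close>

lemma x_mult_s_poly:
  "[:0, 1:] * s_poly \<alpha> k =
     s_poly \<alpha> (Suc k) + smult (if k = 0 then 0 else \<alpha> k) (s_poly \<alpha> (k - 1))"
  by (cases k) simp_all

text \<open>Multiplication by the variable is symmetric for the bilinear form of a functional.\<close>

lemma moment_functional_s_poly_Suc_mult:
  "moment_functional s (s_poly \<alpha> (Suc i) * s_poly \<alpha> j) =
     moment_functional s (s_poly \<alpha> i * s_poly \<alpha> (Suc j))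
     + (if j = 0 then 0 else \<alpha> j) * moment_functional s (s_poly \<alpha> i * s_poly \<alpha> (j - 1))
     - (if i = 0 then 0 else \<alpha> i) * moment_functional s (s_poly \<alpha> (i - 1) * s_poly \<alpha> j)"
proof -
  define A where "A = smult (if i = 0 then 0 else \<alpha> i) (s_poly \<alpha> (i - 1))"
  define B where "B = smult (if j = 0 then 0 else \<alpha> j) (s_poly \<alpha> (j - 1))"
  have "s_poly \<alpha> (Suc i) = [:0, 1:] * s_poly \<alpha> i - A"
    unfolding x_mult_s_poly A_def by simp
  hence "s_poly \<alpha> (Suc i) * s_poly \<alpha> j = s_poly \<alpha> i * ([:0, 1:] * s_poly \<alpha> j) - A * s_poly \<alpha> j"
    by (simp only: left_diff_distrib right_diff_distrib mult_ac)
  also have "[:0, 1:] * s_poly \<alpha> j = s_poly \<alpha> (Suc j) + B"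
    unfolding x_mult_s_poly B_def ..
  finally have "s_poly \<alpha> (Suc i) * s_poly \<alpha> j =
      s_poly \<alpha> i * s_poly \<alpha> (Suc j) + s_poly \<alpha> i * B - A * s_poly \<alpha> j"
    by (simp only: distrib_left)
  thus ?thesis
    unfolding A_def B_def by (simp only: moment_functional_linear mult_smult_left mult_smult_right)
qed

text \<open>Favard's argument by induction on i, moving one factor of the variable from left to
  right. For i = j the middle term multiplies the norm by a coefficient; for i = j + 2 the outer
  terms cancel.\<close>

lemma s_poly_orthogonal:
  assumes "\<And>k. moment_functional s (s_poly \<alpha> k) = (if k = 0 then c else 0)"
  shows "moment_functional s (s_poly \<alpha> i * s_poly \<alpha> j) = (if i = j then c * (\<Prod>l=1..i. \<alpha> l) else 0)"
proof (induction i arbitrary: j rule: less_induct)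
  case (less i)
  show ?case
  proof (cases i)
    case 0
    thus ?thesis using assms[of j] by simp
  next
    case (Suc k)
    have IH: "moment_functional s (s_poly \<alpha> k * s_poly \<alpha> j) = (if k = j then c * (\<Prod>l=1..k. \<alpha> l) else 0)" for j
      by (rule less) (simp add: Suc)
    have IH': "moment_functional s (s_poly \<alpha> (k - 1) * s_poly \<alpha> j) =
        (if k - 1 = j then c * (\<Prod>l=1..k - 1. \<alpha> l) else 0)" for j
      by (rule less) (simp add: Suc)
    show ?thesis
      unfolding Suc moment_functional_s_poly_Suc_mult IH IH'
      by (cases k; cases j) auto
  qed
qed

lemma s_poly_expansion:
  assumes "degree p \<le> n"
  obtains d where "p = (\<Sum>i\<le>n. smult (d i) (s_poly \<alpha> i))"
proof -
  have "\<exists>d. p = (\<Sum>i\<le>n. smult (d i) (s_poly \<alpha> i))"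
    using assms
  proof (induction n arbitrary: p)
    case 0
    then obtain c where "p = [:c:]" by (auto elim: degree_eq_zeroE)
    thus ?case by (auto intro!: exI[of _ "\<lambda>_. c"])
  next
    case (Suc n)
    define q where "q = p - smult (coeff p (Suc n)) (s_poly \<alpha> (Suc n))"
    have "degree q \<le> n"
    proof (rule degree_le, intro allI impI)
      fix i assume "n < i"
      thus "coeff q i = 0"
        using Suc.prems by (cases "i = Suc n") (auto simp: q_def coeff_eq_0 simp del: s_poly.simps)
    qed
    then obtain d where d: "q = (\<Sum>i\<le>n. smult (d i) (s_poly \<alpha> i))"
      using Suc.IH by blast
    have "p = q + smult (coeff p (Suc n)) (s_poly \<alpha> (Suc n))"
      by (simp add: q_def)
    also have "\<dots> = (\<Sum>i\<le>Suc n. smult ((d(Suc n := coeff p (Suc n))) i) (s_poly \<alpha> i))"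
      by (simp add: d del: s_poly.simps)
    finally show ?case by blast
  qed
  thus thesis using that by blast
qed

text \<open>The product of c and \<alpha>_1, ..., \<alpha>_i is the squared norm of R_i, so these
  are Parseval's identity and the formula for the expansion coefficients.\<close>

lemma moment_functional_square_expansion:
  assumes "\<And>k. moment_functional s (s_poly \<alpha> k) = (if k = 0 then c else 0)"
    and p: "p = (\<Sum>i\<le>n. smult (d i) (s_poly \<alpha> i))"
  shows "moment_functional s (p * p) = (\<Sum>i\<le>n. (d i)\<^sup>2 * (c * (\<Prod>l=1..i. \<alpha> l)))"
    and "moment_functional s (s_poly \<alpha> m * p) = (if m \<le> n then d m * (c * (\<Prod>l=1..m. \<alpha> l)) else 0)"
proof -
  show *: "moment_functional s (s_poly \<alpha> m * p) = (if m \<le> n then d m * (c * (\<Prod>l=1..m. \<alpha> l)) else 0)" for m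
    unfolding p
    by (simp add: sum_distrib_left moment_functional_sum moment_functional_smult
        s_poly_orthogonal[OF assms(1)] if_distrib[of "\<lambda>x. _ * x"] cong: if_cong)
  have "p * p = (\<Sum>i\<le>n. smult (d i) (s_poly \<alpha> i * p))"
    by (subst (1) p) (simp add: sum_distrib_right)
  hence "moment_functional s (p * p) = (\<Sum>i\<le>n. d i * moment_functional s (s_poly \<alpha> i * p))"
    by (simp add: moment_functional_sum moment_functional_smult)
  thus "moment_functional s (p * p) = (\<Sum>i\<le>n. (d i)\<^sup>2 * (c * (\<Prod>l=1..i. \<alpha> l)))"
    unfolding * by (simp add: power2_eq_square mult.assoc)
qed

section \<open>Real roots and Lagrange interpolation\<close>

text \<open>A non-real root a + ib is also a root of the real quadratic. The remainder on division
  by it has degree at most 1 and real coefficients and vanishes at a non-real point, so it is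
  0.\<close>

lemma real_poly_quadratic_factor:
  fixes p :: "real poly"
  assumes "degree p > 0" and "\<And>x. poly p x \<noteq> 0"
  obtains a b where "[:-a, 1:] ^ 2 + [:b\<^sup>2:] dvd p"
proof -
  let ?ev = "\<lambda>q z. poly (map_poly complex_of_real q) z"
  have ev_add: "?ev (q + r) z = ?ev q z + ?ev r z" for q r z
  proof -
    have "map_poly complex_of_real (q + r) = map_poly complex_of_real q + map_poly complex_of_real r"
      by (intro poly_eqI) (simp add: coeff_map_poly)
    thus ?thesis by simp
  qed
  have ev_mult: "?ev (q * r) z = ?ev q z * ?ev r z" for q r z
  proof -
    have "map_poly complex_of_real (q * r) = map_poly complex_of_real q * map_poly complex_of_real r"
      by (intro poly_eqI) (simp add: coeff_map_poly coeff_mult)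
    thus ?thesis by simp
  qed
  have "degree (map_poly complex_of_real p) = degree p"
    by (simp add: degree_map_poly)
  with assms(1) have "\<not> (\<exists>a l. a \<noteq> 0 \<and> l = 0 \<and> map_poly complex_of_real p = pCons a l)"
    by auto
  from fundamental_theorem_of_algebra_alt[OF this] obtain z where z: "?ev p z = 0"
    by blast
  define a b where "a = Re z" and "b = Im z"
  have "b \<noteq> 0"
  proof
    assume "b = 0"
    hence "z = of_real a" by (simp add: a_def b_def complex_eq_iff)
    moreover have "?ev p (of_real a) = of_real (poly p a)"
      by (induction p) (simp_all add: map_poly_pCons)
    ultimately show False using z assms(2)[of a] by simp
  qed
  define m where "m = [:-a, 1:] ^ 2 + [:b\<^sup>2:]"
  have m: "m = [:a\<^sup>2 + b\<^sup>2, - 2 * a, 1:]"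
    by (simp add: m_def power2_eq_square)
  have "?ev m z = 0"
    by (simp add: m map_poly_pCons a_def b_def complex_eq_iff power2_eq_square algebra_simps)
  moreover have "p = p div m * m + p mod m" by simp
  ultimately have ev: "?ev (p mod m) z = 0"
    using z ev_add ev_mult by (metis add_0 mult_zero_right)
  have "degree (p mod m) < 2"
    using degree_mod_less[of m p] by (auto simp: m)
  hence uv: "p mod m = [:coeff (p mod m) 0, coeff (p mod m) 1:]"
    by (intro poly_eqI) (auto simp: coeff_pCons coeff_eq_0 split: nat.split)
  define u v where "u = coeff (p mod m) 0" and "v = coeff (p mod m) 1"
  have uv: "p mod m = [:u, v:]" unfolding u_def v_def by (rule uv)
  with ev have "complex_of_real u + z * complex_of_real v = 0"
    by (simp add: map_poly_pCons)
  hence "v = 0" "u = 0"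
    using \<open>b \<noteq> 0\<close> by (auto simp: complex_eq_iff b_def)
  hence "m dvd p" using uv by (simp add: dvd_eq_mod_eq_0)
  thus thesis using that by (simp add: m_def)
qed

lemma prod_linear_dvd_poly:
  fixes p :: "real poly"
  assumes "finite A" "\<And>x. x \<in> A \<Longrightarrow> poly p x = 0"
  shows "(\<Prod>x\<in>A. [:-x, 1:]) dvd p"
  using assms
proof (induction A)
  case (insert x A)
  then obtain q where q: "p = (\<Prod>x\<in>A. [:-x, 1:]) * q"
    by (auto elim: dvdE)
  have "poly (\<Prod>x\<in>A. [:-x, 1:]) x \<noteq> 0"
    using insert by (auto simp: poly_prod)
  moreover have "poly p x = 0" using insert by auto
  ultimately have "[:-x, 1:] dvd q" by (simp add: q poly_eq_0_iff_dvd)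
  hence "[:-x, 1:] * (\<Prod>x\<in>A. [:-x, 1:]) dvd q * (\<Prod>x\<in>A. [:-x, 1:])"
    by (rule mult_dvd_mono) simp
  thus ?case unfolding prod.insert[OF insert.hyps] by (simp only: q mult.commute)
qed auto

text \<open>With the distinct real roots divided out, a nonconstant quotient has either a real root,
  which is a multiple root of p (the case b = 0), or a non-real pair. One form for both cases lets a
  single positivity argument exclude them.\<close>

lemma real_poly_simple_real_roots_or_factor:
  fixes p :: "real poly"
  assumes "p \<noteq> 0"
  shows "card {x. poly p x = 0} = degree p \<or> (\<exists>a b. [:-a, 1:] ^ 2 + [:b\<^sup>2:] dvd p)"
proof -
  define A where "A = {x. poly p x = 0}"
  have fin: "finite A" unfolding A_def by (rule poly_roots_finite) fact
  have "(\<Prod>x\<in>A. [:-x, 1:]) dvd p"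
    by (rule prod_linear_dvd_poly[OF fin]) (simp add: A_def)
  then obtain q where q: "p = (\<Prod>x\<in>A. [:-x, 1:]) * q" by (rule dvdE)
  have "degree (\<Prod>x\<in>A. [:-x, 1:]) = card A"
    by (subst degree_prod_eq_sum_degree) auto
  moreover have "(\<Prod>x\<in>A. [:-x, 1:]) \<noteq> 0" "q \<noteq> 0"
    using assms q by (metis mult_zero_left, metis mult_zero_right)
  ultimately have deg: "degree p = card A + degree q"
    by (metis degree_mult_eq q)
  show ?thesis
  proof (cases "degree q = 0")
    case True
    thus ?thesis using deg by (simp add: A_def)
  next
    case False
    show ?thesis
    proof (cases "\<exists>x. poly q x = 0")
      case True
      then obtain x where x: "poly q x = 0" by blast
      have "poly p x = 0" by (subst q) (simp add: x)
      hence "x \<in> A" by (simp add: A_def)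
      hence "[:-x, 1:] dvd (\<Prod>x\<in>A. [:-x, 1:])"
        using fin by (metis dvd_prodI)
      moreover have "[:-x, 1:] dvd q" using x by (simp add: poly_eq_0_iff_dvd)
      ultimately have "[:-x, 1:] * [:-x, 1:] dvd p"
        by (subst q) (rule mult_dvd_mono)
      hence "[:-x, 1:] ^ 2 + [:0\<^sup>2:] dvd p"
        by (simp add: power2_eq_square)
      thus ?thesis by blast
    next
      case no_root: False
      with False obtain a b where "[:-a, 1:] ^ 2 + [:b\<^sup>2:] dvd q"
        using real_poly_quadratic_factor[of q] by blast
      hence "[:-a, 1:] ^ 2 + [:b\<^sup>2:] dvd p" by (subst q) (rule dvd_mult)
      thus ?thesis by blast
    qed
  qed
qed

definition lagrange_poly :: "real set \<Rightarrow> real \<Rightarrow> real poly" where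
  "lagrange_poly A x = smult (inverse (\<Prod>z\<in>A - {x}. x - z)) (\<Prod>z\<in>A - {x}. [:-z, 1:])"

lemma poly_lagrange_poly:
  assumes "finite A" "x \<in> A" "y \<in> A"
  shows "poly (lagrange_poly A x) y = (if x = y then 1 else 0)"
  using assms by (auto simp: lagrange_poly_def poly_prod)

lemma degree_lagrange_poly:
  assumes "finite A" "x \<in> A"
  shows "degree (lagrange_poly A x) < card A"
proof -
  have "degree (lagrange_poly A x) \<le> card (A - {x})"
    unfolding lagrange_poly_def
    by (rule order.trans[OF degree_smult_le]) (subst degree_prod_eq_sum_degree, auto)
  also have "\<dots> < card A"
    using assms by (rule card_Diff1_less)
  finally show ?thesis .
qed

lemma lagrange_interpolation:
  assumes "finite A" "degree p < card A"
  shows "p = (\<Sum>x\<in>A. smult (poly p x) (lagrange_poly A x))"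
proof (rule poly_eqI_degree)
  fix y assume "y \<in> A"
  thus "poly p y = poly (\<Sum>x\<in>A. smult (poly p x) (lagrange_poly A x)) y"
    using assms by (simp add: poly_sum poly_lagrange_poly if_distrib[of "\<lambda>x. _ * x"] cong: if_cong)
next
  show "degree (\<Sum>x\<in>A. smult (poly p x) (lagrange_poly A x)) < card A"
    using assms degree_lagrange_poly[of A]
    by (intro degree_sum_less) (auto intro: le_less_trans[OF degree_smult_le])
qed (use assms in auto)

text \<open>
  If some coefficient \<open>\<alpha>\<^sub>M\<close> vanishes, the functional is degenerate and the nodes are
  the roots of the first polynomial of norm zero, which gives a rule exact in all degrees.
\<close>

lemma gauss_quadrature:
  assumes L: "\<And>k. moment_functional s (s_poly \<alpha> k) = (if k = 0 then c else 0)"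
    and "c > 0" and \<alpha>: "\<And>k. k \<ge> 1 \<Longrightarrow> \<alpha> k \<ge> 0" and "N \<ge> 1"
  obtains A w where "finite A" "\<And>x. x \<in> A \<Longrightarrow> w x \<ge> 0"
    "\<And>p. degree p < 2 * N \<Longrightarrow> moment_functional s p = (\<Sum>x\<in>A. w x * poly p x)"
proof -
  let ?L = "moment_functional s"
  define h where "h i = c * (\<Prod>l=1..i. \<alpha> l)" for i
  \<comment> \<open>The number of nodes: N, or the first index with vanishing
    \<open>\<alpha>\<close> if that is smaller. The squared norms \<open>h i\<close> are positive
    below M.\<close>
  define M where "M = (LEAST M. M \<ge> 1 \<and> (M = N \<or> \<alpha> M = 0))"
  have "M \<ge> 1 \<and> (M = N \<or> \<alpha> M = 0)"
    unfolding M_def by (rule LeastI[of _ N]) (use \<open>N \<ge> 1\<close> in auto)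
  moreover have "M \<le> N"
    unfolding M_def by (rule Least_le) (use \<open>N \<ge> 1\<close> in auto)
  moreover have pos: "\<alpha> i > 0" if "1 \<le> i" "i < M" for i
    using not_less_Least[OF that(2)[unfolded M_def]] that \<alpha>[of i] by auto
  ultimately have M: "M \<ge> 1" "M \<le> N" "M \<noteq> N \<Longrightarrow> \<alpha> M = 0" by auto
  have h_pos: "h i > 0" if "i < M" for i
    unfolding h_def using \<open>c > 0\<close> that by (intro mult_pos_pos prod_pos) (auto intro!: pos)
  have h_M: "h M = 0" if "M \<noteq> N"
  proof -
    have "(\<Prod>l=1..M. \<alpha> l) = 0" using M that by (intro prod_zero) auto
    thus ?thesis by (simp add: h_def)
  qed
  have square_nonneg: "?L (p * p) \<ge> 0" for p
  proof -
    obtain d where "p = (\<Sum>i\<le>degree p. smult (d i) (s_poly \<alpha> i))"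
      using s_poly_expansion[of p "degree p" \<alpha>] by blast
    from moment_functional_square_expansion(1)[OF L this] show ?thesis
      using \<open>c > 0\<close> by (auto intro!: sum_nonneg mult_nonneg_nonneg prod_nonneg \<alpha>)
  qed
  have square_pos: "?L (p * p) > 0" if "p \<noteq> 0" "degree p < M" for p
  proof -
    obtain d where d: "p = (\<Sum>i\<le>degree p. smult (d i) (s_poly \<alpha> i))"
      using s_poly_expansion[of p "degree p" \<alpha>] by blast
    have "\<exists>i\<le>degree p. d i \<noteq> 0"
    proof (rule ccontr)
      assume "\<not> ?thesis"
      hence "(\<Sum>i\<le>degree p. smult (d i) (s_poly \<alpha> i)) = 0" by (intro sum.neutral) auto
      with d that(1) show False by simp
    qed
    then obtain i where i: "i \<le> degree p" "d i \<noteq> 0" by blast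
    have "0 < (\<Sum>i\<le>degree p. (d i)\<^sup>2 * h i)"
    proof (rule sum_pos2)
      show "0 < (d i)\<^sup>2 * h i" using i that h_pos[of i] by simp
      fix j assume "j \<in> {..degree p}"
      thus "0 \<le> (d j)\<^sup>2 * h j" using that h_pos[of j] by simp
    qed (use i in auto)
    thus ?thesis
      using moment_functional_square_expansion(1)[OF L d] by (simp add: h_def)
  qed
  \<comment> \<open>For M = N the bound forces \<open>degree q < M\<close> and orthogonality
    applies; for M < N the polynomial R_M has norm zero and is orthogonal to every q.\<close>
  have orth: "?L (s_poly \<alpha> M * q) = 0" if "M + degree q < 2 * N" for q
  proof -
    obtain d where d: "q = (\<Sum>i\<le>degree q. smult (d i) (s_poly \<alpha> i))"
      using s_poly_expansion[of q "degree q" \<alpha>] by blast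
    from moment_functional_square_expansion(2)[OF L this, of M] show ?thesis
      using that h_M by (cases "M = N") (auto simp: h_def)
  qed
  define A where "A = {x. poly (s_poly \<alpha> M) x = 0}"
  have nz: "s_poly \<alpha> M \<noteq> 0" using lead_coeff_s_poly[of \<alpha> M] by (metis coeff_0 zero_neq_one)
  have fin: "finite A" unfolding A_def by (rule poly_roots_finite) fact
  \<comment> \<open>The zeros are real and simple: a factor (x - a)^2 + b^2 with cofactor q would
    make L(R_M q) = L(r^2) + b^2 L(q^2) positive, against orthogonality.\<close>
  have card: "card A = M"
  proof (rule ccontr)
    assume "card A \<noteq> M"
    then obtain a b where "[:-a, 1:] ^ 2 + [:b\<^sup>2:] dvd s_poly \<alpha> M"
      using real_poly_simple_real_roots_or_factor[OF nz] by (auto simp: A_def)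
    then obtain q where q: "s_poly \<alpha> M = ([:-a, 1:] ^ 2 + [:b\<^sup>2:]) * q" by (rule dvdE)
    have "q \<noteq> 0" using q nz by auto
    have "degree (s_poly \<alpha> M) = 2 + degree q"
    proof -
      have "[:-a, 1:] ^ 2 + [:b\<^sup>2:] = [:a\<^sup>2 + b\<^sup>2, - 2 * a, 1:]"
        by (simp add: power2_eq_square)
      thus ?thesis unfolding q using \<open>q \<noteq> 0\<close> by (subst degree_mult_eq) auto
    qed
    hence deg: "M = 2 + degree q" by simp
    define r where "r = [:-a, 1:] * q"
    have "r \<noteq> 0" "degree r < M"
      using \<open>q \<noteq> 0\<close> deg by (auto simp: r_def degree_mult_eq simp del: mult_pCons_left)
    have "s_poly \<alpha> M * q = r * r + smult (b\<^sup>2) (q * q)"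
    proof -
      have "(l ^ 2 + m) * q * q = (l * q) * (l * q) + m * (q * q)" for l m :: "real poly"
        by (simp add: power2_eq_square algebra_simps)
      from this[of "[:-a, 1:]" "[:b\<^sup>2:]"] show ?thesis
        unfolding q r_def by simp
    qed
    hence "?L (s_poly \<alpha> M * q) = ?L (r * r) + b\<^sup>2 * ?L (q * q)"
      by (simp add: moment_functional_linear)
    moreover have "?L (s_poly \<alpha> M * q) = 0"
      by (rule orth) (use deg M in simp)
    ultimately show False
      using square_pos[OF \<open>r \<noteq> 0\<close> \<open>degree r < M\<close>] square_nonneg[of q]
      by (metis add_pos_nonneg less_irrefl mult_nonneg_nonneg zero_le_power2)
  qed
  define w where "w x = ?L (lagrange_poly A x)" for x
  \<comment> \<open>Division by R_M: the quotient part has value 0, and the remainder is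
    interpolated at the zeros, where it agrees with p.\<close>
  have quad: "?L p = (\<Sum>x\<in>A. w x * poly p x)" if "degree p < 2 * N" for p
  proof -
    define q r where "q = p div s_poly \<alpha> M" and "r = p mod s_poly \<alpha> M"
    have p: "p = s_poly \<alpha> M * q + r" by (simp add: q_def r_def)
    have r: "degree r < M"
      using degree_mod_less'[of "s_poly \<alpha> M" p] M nz unfolding r_def
      by (cases "p mod s_poly \<alpha> M = 0") auto
    have "?L (s_poly \<alpha> M * q) = 0"
    proof (cases "q = 0")
      case False
      have "degree (s_poly \<alpha> M * q) = M + degree q"
        using False nz by (simp add: degree_mult_eq)
      moreover have "degree p = degree (s_poly \<alpha> M * q)"
        unfolding p using r calculation by (intro degree_add_eq_left) simp
      ultimately show ?thesis using that by (intro orth) simp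
    qed simp
    hence "?L p = ?L r" by (simp add: p moment_functional_add)
    also have "\<dots> = (\<Sum>x\<in>A. w x * poly r x)"
      by (subst lagrange_interpolation[OF fin, of r])
         (use r card in \<open>simp_all add: moment_functional_sum moment_functional_smult w_def mult.commute\<close>)
    also have "\<dots> = (\<Sum>x\<in>A. w x * poly p x)"
      by (rule sum.cong) (auto simp: p A_def)
    finally show ?thesis .
  qed
  \<comment> \<open>The rule is exact on the square of a Lagrange polynomial, whose degree is at
    most 2M - 2, and returns precisely the weight.\<close>
  have "w x \<ge> 0" if "x \<in> A" for x
  proof -
    let ?l = "lagrange_poly A x"
    have "degree (?l * ?l) < 2 * N"
      using degree_mult_le[of ?l ?l] degree_lagrange_poly[OF fin that] card M by simp
    hence "?L (?l * ?l) = (\<Sum>y\<in>A. w y * poly (?l * ?l) y)" by (rule quad)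
    also have "\<dots> = (\<Sum>y\<in>A. if y = x then w x else 0)"
      by (rule sum.cong) (use fin that in \<open>auto simp: poly_lagrange_poly\<close>)
    also have "\<dots> = w x" using fin that by simp
    finally show ?thesis using square_nonneg[of ?l] by simp
  qed
  with fin quad show thesis using that by blast
qed

section \<open>Recurrence coefficients of a positive symmetric functional\<close>

text \<open>Degenerate case of Cauchy-Schwarz: otherwise the value at the square of p + tq would be
  affine in t with nonzero slope.\<close>

lemma moment_functional_null_mult:
  assumes pos: "\<And>p. moment_functional s (p * p) \<ge> 0" and "moment_functional s (q * q) = 0"
  shows "moment_functional s (p * q) = 0"
proof (rule ccontr)
  let ?L = "moment_functional s"
  assume nz: "?L (p * q) \<noteq> 0"
  \<comment> \<open>Chosen so that the value at the square is -1.\<close>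
  define t where "t = - (?L (p * p) + 1) / (2 * ?L (p * q))"
  have "(p + u) * (p + u) = p * p + (p * u + p * u) + u * u" for u
    by (simp add: algebra_simps)
  hence "?L ((p + smult t q) * (p + smult t q)) = ?L (p * p) + 2 * t * ?L (p * q)"
    using assms(2) by (simp only: moment_functional_linear mult_smult_left mult_smult_right)
  also have "\<dots> = - 1" using nz by (simp add: t_def field_simps)
  finally show False using pos[of "p + smult t q"] by simp
qed

text \<open>Stieltjes' procedure: \<open>\<alpha> k\<close> is the quotient of consecutive squared
  norms, with division by zero giving 0. Once a norm vanishes all later ones do; the second
  conclusion records this for the recovery of the parameters g.\<close>

theorem ex_orthogonal_s_poly:
  assumes pos: "\<And>p. moment_functional s (p * p) \<ge> 0" and odd: "\<And>n. odd n \<Longrightarrow> s n = 0"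
  obtains \<alpha> where "\<And>k. \<alpha> k \<ge> 0" "\<And>k. k \<ge> 1 \<Longrightarrow> \<alpha> k = 0 \<Longrightarrow> \<alpha> (Suc k) = 0"
    "\<And>k. k \<ge> 1 \<Longrightarrow> moment_functional s (s_poly \<alpha> k) = 0"
proof -
  let ?L = "moment_functional s"
  \<comment> \<open>Coefficients and polynomials depend on each other, so pairs of consecutive
    polynomials are built first and \<open>\<alpha>\<close> is read off from them.\<close>
  define Q where "Q = rec_nat (1 :: real poly, [:0, 1 :: real:])
    (\<lambda>_ (p, q). (q, [:0, 1:] * q - smult (?L (q * q) / ?L (p * p)) p))"
  define \<alpha> where "\<alpha> k = ?L (fst (Q k) * fst (Q k)) / ?L (fst (Q (k - 1)) * fst (Q (k - 1)))" for k
  have Q_Suc: "fst (Q (Suc k)) = snd (Q k)" for k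
    by (simp add: Q_def split: prod.splits)
  have Q_Suc_Suc: "fst (Q (Suc (Suc k))) =
      [:0, 1:] * fst (Q (Suc k)) - smult (\<alpha> (Suc k)) (fst (Q k))" for k
  proof -
    have "snd (Q (Suc k)) = [:0, 1:] * snd (Q k) -
        smult (?L (snd (Q k) * snd (Q k)) / ?L (fst (Q k) * fst (Q k))) (fst (Q k))"
      by (simp add: Q_def split: prod.splits)
    thus ?thesis by (simp only: Q_Suc \<alpha>_def diff_Suc_1)
  qed
  have R: "s_poly \<alpha> k = fst (Q k)" for k
  proof (induction k rule: less_induct)
    case (less k)
    consider "k = 0" | "k = Suc 0" | m where "k = Suc (Suc m)"
      by (metis nat.exhaust)
    thus ?case
    proof cases
      case 3
      thus ?thesis unfolding 3 Q_Suc_Suc s_poly.simps(3) using less[of m] less[of "Suc m"] 3 by simp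
    qed (simp_all add: Q_def)
  qed
  define h where "h k = ?L (s_poly \<alpha> k * s_poly \<alpha> k)" for k
  have \<alpha>: "\<alpha> k = h k / h (k - 1)" for k
    by (simp add: \<alpha>_def h_def R)
  have h_nonneg: "h k \<ge> 0" for k by (simp add: h_def pos)
  \<comment> \<open>A null R_k is orthogonal to everything; expanding one factor R_(k+1) by the
    recurrence then makes R_(k+1) null too.\<close>
  have h_Suc_0: "h (Suc k) = 0"
    if "h k = 0" and orth: "\<And>i. i < Suc k \<Longrightarrow> ?L (s_poly \<alpha> i * s_poly \<alpha> (Suc k)) = 0" for k
  proof -
    have "s_poly \<alpha> (Suc k) * s_poly \<alpha> (Suc k) =
        ([:0, 1:] * s_poly \<alpha> (Suc k)) * s_poly \<alpha> k
          - smult (if k = 0 then 0 else \<alpha> k) (s_poly \<alpha> (k - 1) * s_poly \<alpha> (Suc k))"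
    proof -
      have "z = x * y - w \<Longrightarrow> z * z = (x * z) * y - w * z" for x y z w :: "real poly"
        by algebra
      from this[of "s_poly \<alpha> (Suc k)" "[:0, 1:]" "s_poly \<alpha> k"
          "smult (if k = 0 then 0 else \<alpha> k) (s_poly \<alpha> (k - 1))"]
      show ?thesis unfolding x_mult_s_poly[of \<alpha> k] by (simp only: mult_smult_left add_diff_cancel_right')
    qed
    moreover have "?L (([:0, 1:] * s_poly \<alpha> (Suc k)) * s_poly \<alpha> k) = 0"
      using that(1) unfolding h_def by (rule moment_functional_null_mult[OF pos])
    ultimately show ?thesis
      using orth[of "k - 1"] by (simp add: h_def moment_functional_linear)
  qed
  \<comment> \<open>With j = k + 1, symmetry of multiplication by y leaves three cases: i = k by
    parity, i = k - 1 by the choice of \<open>\<alpha> k\<close>, and smaller i by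
    induction.\<close>
  have orth: "?L (s_poly \<alpha> i * s_poly \<alpha> j) = 0" if "i < j" for i j
    using that
  proof (induction j arbitrary: i rule: less_induct)
    case (less j)
    then obtain k where k: "j = Suc k" by (cases j) auto
    have IH: "?L (s_poly \<alpha> i * s_poly \<alpha> k) = 0" if "i < k" for i
      using less.IH[of k i] that k by simp
    have *: "?L (s_poly \<alpha> j * s_poly \<alpha> i) = ?L (s_poly \<alpha> k * s_poly \<alpha> (Suc i))
        + (if i = 0 then 0 else \<alpha> i) * ?L (s_poly \<alpha> k * s_poly \<alpha> (i - 1))
        - (if k = 0 then 0 else \<alpha> k) * ?L (s_poly \<alpha> (k - 1) * s_poly \<alpha> i)"
      unfolding k by (rule moment_functional_s_poly_Suc_mult)
    have "i \<le> k" using less.prems k by simp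
    then consider "i = k" | "k = Suc i" | "Suc i < k" by linarith
    hence "?L (s_poly \<alpha> j * s_poly \<alpha> i) = 0"
    proof cases
      case 1
      have "?L ([:0, 1:] * (s_poly \<alpha> k * s_poly \<alpha> k)) = 0"
      proof (rule moment_functional_reflect_odd[OF odd])
        have "((-1 :: real) ^ k * (-1) ^ k) = 1" by (simp flip: power_mult_distrib)
        thus "pcompose ([:0, 1:] * (s_poly \<alpha> k * s_poly \<alpha> k)) [:0, -1:]
            = - ([:0, 1:] * (s_poly \<alpha> k * s_poly \<alpha> k))"
          by (simp only: pcompose_mult s_poly_reflect mult_smult_left mult_smult_right smult_smult)
             (simp add: pcompose_pCons)
      qed
      moreover have "s_poly \<alpha> j * s_poly \<alpha> k = [:0, 1:] * (s_poly \<alpha> k * s_poly \<alpha> k)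
          - smult (if k = 0 then 0 else \<alpha> k) (s_poly \<alpha> (k - 1) * s_poly \<alpha> k)"
      proof -
        have "z = x * y - w \<Longrightarrow> z * y = x * (y * y) - w * y" for x y z w :: "real poly"
          by algebra
        from this[of "s_poly \<alpha> (Suc k)" "[:0, 1:]" "s_poly \<alpha> k"
            "smult (if k = 0 then 0 else \<alpha> k) (s_poly \<alpha> (k - 1))"]
        show ?thesis unfolding k x_mult_s_poly[of \<alpha> k] by (simp only: mult_smult_left add_diff_cancel_right')
      qed
      moreover have "(if k = 0 then 0 else \<alpha> k) * ?L (s_poly \<alpha> (k - 1) * s_poly \<alpha> k) = 0"
        using IH[of "k - 1"] by simp
      ultimately show ?thesis
        unfolding 1 by (simp only: moment_functional_linear)
    next
      case 2
      have "(if i = 0 then 0 else \<alpha> i) * ?L (s_poly \<alpha> k * s_poly \<alpha> (i - 1)) = 0"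
        using IH[of "i - 1"] 2 by (simp add: mult.commute)
      \<comment> \<open>If \<open>h i = 0\<close>, the left side is 0 and \<open>h k\<close> is 0 by
        propagation; otherwise this is the definition of \<open>\<alpha> k\<close>.\<close>
      moreover have "\<alpha> k * h i = h k"
        using h_Suc_0[of i] IH 2 by (cases "h i = 0") (auto simp: \<alpha>)
      ultimately show ?thesis
        unfolding * using 2 by (simp add: h_def)
    next
      case 3
      have "?L (s_poly \<alpha> (k - 1) * s_poly \<alpha> i) = 0"
        using less.IH[of "k - 1" i] 3 k by (simp add: mult.commute)
      moreover have "?L (s_poly \<alpha> k * s_poly \<alpha> (i - 1)) = 0" "?L (s_poly \<alpha> k * s_poly \<alpha> (Suc i)) = 0"
        using IH[of "i - 1"] IH[of "Suc i"] 3 by (simp_all only: mult.commute)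
      ultimately show ?thesis unfolding * by simp
    qed
    thus ?case by (simp only: mult.commute)
  qed
  show thesis
  proof (rule that[of \<alpha>])
    show "\<alpha> k \<ge> 0" for k
      unfolding \<alpha> using h_nonneg by simp
    show "\<alpha> (Suc k) = 0" if "k \<ge> 1" "\<alpha> k = 0" for k
    proof -
      \<comment> \<open>A zero quotient may also come from \<open>h (k - 1) = 0\<close>; the null
        norm then propagates to \<open>h k\<close>.\<close>
      have "h k = 0"
        using that \<alpha>[of k] h_Suc_0[of "k - 1"] orth by (auto simp: divide_eq_0_iff)
      thus ?thesis by (simp add: \<alpha>)
    qed
    show "?L (s_poly \<alpha> k) = 0" if "k \<ge> 1" for k
      using orth[of 0 k] that by simp
  qed
qed

section \<open>The moment problem on the real line\<close>

text \<open>Clipping moves u by at most its absolute value, and beyond the level R this is at most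
  u^2 / R.\<close>

lemma clip_error:
  assumes "R > 0"
  shows "\<bar>u - max (- R) (min R u)\<bar> \<le> u\<^sup>2 / (R :: real)"
proof (cases "\<bar>u\<bar> \<le> R")
  case True
  hence "max (- R) (min R u) = u" by auto
  thus ?thesis using assms by simp
next
  case False
  hence "\<bar>u - max (- R) (min R u)\<bar> \<le> \<bar>u\<bar>" using assms by (auto simp: max_def min_def)
  also have "\<bar>u\<bar> * R \<le> \<bar>u\<bar> * \<bar>u\<bar>" using False by (intro mult_left_mono) auto
  hence "\<bar>u\<bar> \<le> u\<^sup>2 / R" using assms by (simp add: field_simps power2_eq_square)
  finally show ?thesis .
qed

text \<open>The bound depends on the measure only through the integral of u^2, so it is uniform over
  measures sharing that value.\<close>

lemma (in finite_measure) integral_clip_error: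
  fixes u :: "'a \<Rightarrow> real"
  assumes "R > 0" and "integrable M u" and "integrable M (\<lambda>x. (u x)\<^sup>2)"
  shows "\<bar>(\<integral>x. u x \<partial>M) - (\<integral>x. max (- R) (min R (u x)) \<partial>M)\<bar> \<le> (\<integral>x. (u x)\<^sup>2 \<partial>M) / R"
proof -
  have [measurable]: "u \<in> borel_measurable M" using assms by auto
  have clip: "integrable M (\<lambda>x. max (- R) (min R (u x)))"
    by (rule integrable_const_bound[where B = R]) (use \<open>R > 0\<close> in \<open>auto simp: abs_le_iff\<close>)
  have "\<bar>(\<integral>x. u x \<partial>M) - (\<integral>x. max (- R) (min R (u x)) \<partial>M)\<bar> =
      \<bar>\<integral>x. u x - max (- R) (min R (u x)) \<partial>M\<bar>"
    using assms clip by simp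
  also have "\<dots> \<le> (\<integral>x. \<bar>u x - max (- R) (min R (u x))\<bar> \<partial>M)"
    by (rule integral_abs_bound)
  also have "\<dots> \<le> (\<integral>x. (u x)\<^sup>2 / R \<partial>M)"
    by (rule integral_mono) (use assms clip clip_error in auto)
  finally show ?thesis by simp
qed

text \<open>Chebyshev's inequality with a common bound on the second moments.\<close>

lemma moments_imp_tight:
  assumes "\<And>k. real_distribution (\<mu> k)" and "\<And>k. integrable (\<mu> k) (\<lambda>x. x\<^sup>2)"
    and "\<And>k. (\<integral>x. x\<^sup>2 \<partial>\<mu> k) \<le> B"
  shows "tight \<mu>"
  unfolding tight_def
proof (intro conjI allI impI)
  fix e :: real assume "e > 0"
  \<comment> \<open>Since R is at least 1, R e \<le> R^2 e, and the second entry of the maximum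
    makes this exceed B.\<close>
  define R where "R = max 1 ((\<bar>B\<bar> + 1) / e)"
  have R: "R \<ge> 1" "R \<ge> (\<bar>B\<bar> + 1) / e" by (auto simp: R_def)
  have "\<bar>B\<bar> + 1 \<le> R * e" using R(2) \<open>e > 0\<close> by (simp add: field_simps)
  also have "\<dots> \<le> R\<^sup>2 * e"
    using R(1) \<open>e > 0\<close> by (intro mult_right_mono) (auto simp: power2_eq_square)
  finally have "B / R\<^sup>2 < e" using R(1) by (auto simp: field_simps)
  have "1 - e < measure (\<mu> k) {- R<..R}" for k
  proof -
    interpret real_distribution "\<mu> k" by (rule assms)
    have "1 - prob {- R<..R} = prob (UNIV - {- R<..R})"
      using prob_compl[of "{- R<..R}"] by simp
    also have "\<dots> \<le> prob {x \<in> space (\<mu> k). R\<^sup>2 \<le> x\<^sup>2}"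
    proof (rule finite_measure_mono)
      show "UNIV - {- R<..R} \<subseteq> {x \<in> space (\<mu> k). R\<^sup>2 \<le> x\<^sup>2}"
      proof
        fix x assume "x \<in> UNIV - {- R<..R}"
        hence "\<bar>R\<bar> \<le> \<bar>x\<bar>" using R by auto
        hence "R\<^sup>2 \<le> x\<^sup>2" by (simp add: abs_le_square_iff)
        thus "x \<in> {x \<in> space (\<mu> k). R\<^sup>2 \<le> x\<^sup>2}" by simp
      qed
    qed auto
    also have "\<dots> \<le> (\<integral>x. x\<^sup>2 \<partial>\<mu> k) / R\<^sup>2"
      by (rule integral_Markov_inequality_measure[where A = "{}"]) (use assms R in auto)
    also have "\<dots> \<le> B / R\<^sup>2" using assms(3)[of k] R(1) by (intro divide_right_mono) auto
    finally show ?thesis using \<open>B / R\<^sup>2 < e\<close> by simp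
  qed
  moreover have "- R < R" using R by simp
  ultimately show "\<exists>a b. a < b \<and> (\<forall>k. 1 - e < measure (\<mu> k) {a<..b})" by blast
qed (use assms in auto)

text \<open>Helly's theorem provides a weak limit. Powers are unbounded and are truncated at level
  R; the errors are at most the 2n-th moments divided by R, uniformly along the sequence, so moments
  pass to the limit.\<close>

theorem moment_problem_limit:
  assumes "\<And>N. \<exists>\<nu>. real_distribution \<nu> \<and>
             (\<forall>n\<le>N. integrable \<nu> (\<lambda>x. x ^ n) \<and> (\<integral>x. x ^ n \<partial>\<nu>) = s n)"
  obtains M where "real_distribution M"
    "\<And>n. integrable M (\<lambda>x. x ^ n)" "\<And>n. (\<integral>x. x ^ n \<partial>M) = s n"
proof -
  from assms obtain \<nu> where \<nu>: "\<And>N. real_distribution (\<nu> N)"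
    "\<And>n N. n \<le> N \<Longrightarrow> integrable (\<nu> N) (\<lambda>x. x ^ n)"
    "\<And>n N. n \<le> N \<Longrightarrow> (\<integral>x. x ^ n \<partial>\<nu> N) = s n" by metis
  \<comment> \<open>The shift by 2 makes the second moment of every term equal to
    \<open>s 2\<close>.\<close>
  have "tight (\<lambda>k. \<nu> (k + 2))"
    by (rule moments_imp_tight[where B = "s 2"]) (use \<nu> in auto)
  from tight_imp_convergent_subsubsequence[OF this strict_mono_id]
  obtain r M where r: "strict_mono r" and "real_distribution M"
    and conv: "weak_conv_m (\<lambda>k. \<nu> (r k + 2)) M"
    by (auto simp: o_def)
  interpret M: real_distribution M by fact
  define m where "m k = \<nu> (r k + 2)" for k
  have m: "real_distribution (m k)" for k by (simp add: m_def \<nu>)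
  have m_moment: "integrable (m k) (\<lambda>x. x ^ n)" "(\<integral>x. x ^ n \<partial>m k) = s n" if "n \<le> k" for n k
    using \<nu>(2,3)[of n "r k + 2"] that seq_suble[OF r, of k] by (simp_all add: m_def)
  define \<phi> where "\<phi> R n x = max (- R) (min R (x ^ n))" for R x :: real and n :: nat
  have \<phi>_conv: "(\<lambda>k. \<integral>x. \<phi> R n x \<partial>m k) \<longlonglongrightarrow> (\<integral>x. \<phi> R n x \<partial>M)" if "R \<ge> 0" for R n
  proof (rule weak_conv_imp_integral_bdd_continuous_conv)
    show "weak_conv_m m M" using conv by (simp add: m_def[abs_def])
    show "norm (\<phi> R n x) \<le> R" for x using that by (auto simp: \<phi>_def abs_le_iff)
    show "isCont (\<phi> R n) x" for x unfolding \<phi>_def by (intro continuous_intros)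
  qed (use m M.real_distribution_axioms in auto)
  have \<phi>_meas [measurable]: "\<phi> R n \<in> borel_measurable borel" for R n
    unfolding \<phi>_def by measurable
  have \<phi>_int: "integrable N (\<phi> R n)" if "real_distribution N" "R \<ge> 0" for N R n
  proof -
    interpret N: real_distribution N by fact
    show ?thesis
      by (rule N.integrable_const_bound[where B = R])
         (use \<open>R \<ge> 0\<close> in \<open>auto simp: \<phi>_def abs_le_iff\<close>)
  qed
  \<comment> \<open>Truncated even powers increase with R and have integrals bounded by the
    prescribed moment, so monotone convergence applies.\<close>
  have even_int: "integrable M (\<lambda>x. x ^ (2 * n))" for n
  proof -
    have bound: "(\<integral>x. \<phi> R (2 * n) x \<partial>M) \<le> s (2 * n)" if "R \<ge> 0" for R
    proof (rule LIMSEQ_le_const2[OF \<phi>_conv[OF that]])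
      have "(\<integral>x. \<phi> R (2 * n) x \<partial>m k) \<le> s (2 * n)" if "k \<ge> 2 * n" for k
      proof -
        have "(\<integral>x. \<phi> R (2 * n) x \<partial>m k) \<le> (\<integral>x. x ^ (2 * n) \<partial>m k)"
        proof (rule integral_mono)
          fix x :: real
          have "x ^ (2 * n) \<ge> 0" by (simp add: power_mult)
          hence "- R \<le> x ^ (2 * n)" using \<open>R \<ge> 0\<close> by linarith
          thus "\<phi> R (2 * n) x \<le> x ^ (2 * n)" by (simp add: \<phi>_def)
        qed (use m_moment that \<phi>_int m \<open>R \<ge> 0\<close> in auto)
        thus ?thesis using m_moment(2)[OF that] by simp
      qed
      thus "\<exists>N. \<forall>k\<ge>N. (\<integral>x. \<phi> R (2 * n) x \<partial>m k) \<le> s (2 * n)" by blast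
    qed
    have mono: "incseq (\<lambda>i. \<phi> (real i) (2 * n) x)" for x
    proof (rule incseq_SucI)
      fix i
      have "x ^ (2 * n) \<ge> 0" by (simp add: power_mult)
      thus "\<phi> (real i) (2 * n) x \<le> \<phi> (real (Suc i)) (2 * n) x" unfolding \<phi>_def by linarith
    qed
    have "incseq (\<lambda>i. \<integral>x. \<phi> (real i) (2 * n) x \<partial>M)"
      by (intro incseq_SucI integral_mono incseq_SucD[OF mono] \<phi>_int M.real_distribution_axioms)
         simp_all
    then obtain l where l: "(\<lambda>i. \<integral>x. \<phi> (real i) (2 * n) x \<partial>M) \<longlonglongrightarrow> l"
      by (rule incseq_convergent[where B = "s (2 * n)"]) (use bound in auto)
    show ?thesis
    proof (rule integral_monotone_convergence_nonneg(1)[OF _ _ _ _ l])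
      show "AE x in M. (\<lambda>i. \<phi> (real i) (2 * n) x) \<longlonglongrightarrow> x ^ (2 * n)"
      proof (intro AE_I2 tendsto_eventually)
        fix x :: real
        have "\<phi> (real i) (2 * n) x = x ^ (2 * n)" if "i \<ge> nat \<lceil>x ^ (2 * n)\<rceil>" for i
        proof -
          have "x ^ (2 * n) \<ge> 0" by (simp add: power_mult)
          moreover have "x ^ (2 * n) \<le> real i" using that by linarith
          ultimately show ?thesis unfolding \<phi>_def by linarith
        qed
        thus "\<forall>\<^sub>F i in sequentially. \<phi> (real i) (2 * n) x = x ^ (2 * n)"
          unfolding eventually_sequentially by blast
      qed
      show "AE x in M. 0 \<le> \<phi> (real i) (2 * n) x" for i
        by (intro AE_I2) (auto simp: \<phi>_def power_mult le_max_iff_disj)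
    qed (use \<phi>_int M.real_distribution_axioms mono in auto)
  qed
  have int: "integrable M (\<lambda>x. x ^ n)" for n
  proof (rule Bochner_Integration.integrable_bound)
    show "integrable M (\<lambda>x. 1 + x ^ (2 * n))"
      using even_int[of n] by simp
    show "AE x in M. norm (x ^ n) \<le> norm (1 + x ^ (2 * n))"
    proof (rule AE_I2)
      fix x :: real
      have "0 \<le> (\<bar>x ^ n\<bar> - 1)\<^sup>2" by simp
      hence "2 * \<bar>x ^ n\<bar> \<le> 1 + (x ^ n)\<^sup>2" by (simp add: power2_diff)
      thus "norm (x ^ n) \<le> norm (1 + x ^ (2 * n))"
        by (simp add: power_mult[symmetric] mult.commute abs_if split: if_splits)
    qed
  qed auto
  have "(\<integral>x. x ^ n \<partial>M) = s n" for n
  proof (rule ccontr)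
    \<comment> \<open>Sum of the numerators of the truncation bounds for the limit and for the
      approximants; it is independent of R.\<close>
    define C where "C = (\<integral>x. x ^ (2 * n) \<partial>M) + s (2 * n)"
    assume ne: "(\<integral>x. x ^ n \<partial>M) \<noteq> s n"
    have le: "\<bar>(\<integral>x. x ^ n \<partial>M) - s n\<bar> \<le> C / R" if "R > 0" for R
    proof -
      have sq: "(\<lambda>x::real. (x ^ n)\<^sup>2) = (\<lambda>x. x ^ (2 * n))"
        by (simp add: fun_eq_iff power_mult[symmetric] mult.commute)
      have 1: "\<bar>(\<integral>x. x ^ n \<partial>M) - (\<integral>x. \<phi> R n x \<partial>M)\<bar> \<le> (\<integral>x. x ^ (2 * n) \<partial>M) / R"
        using M.integral_clip_error[of R "\<lambda>x. x ^ n"] that int even_int[of n]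
        unfolding sq \<phi>_def by simp
      have "(\<lambda>k. \<bar>s n - (\<integral>x. \<phi> R n x \<partial>m k)\<bar>) \<longlonglongrightarrow> \<bar>s n - (\<integral>x. \<phi> R n x \<partial>M)\<bar>"
        using \<phi>_conv[of R n] that by (intro tendsto_intros) simp
      moreover have "\<bar>s n - (\<integral>x. \<phi> R n x \<partial>m k)\<bar> \<le> s (2 * n) / R" if "k \<ge> 2 * n" for k
      proof -
        interpret N: real_distribution "m k" by (rule m)
        show ?thesis
          using N.integral_clip_error[of R "\<lambda>x. x ^ n"] that \<open>R > 0\<close> m_moment[of n k] m_moment[of "2 * n" k]
          unfolding sq \<phi>_def by simp
      qed
      ultimately have 2: "\<bar>s n - (\<integral>x. \<phi> R n x \<partial>M)\<bar> \<le> s (2 * n) / R"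
        by (intro LIMSEQ_le_const2) auto
      show ?thesis
        using 1 2 unfolding C_def add_divide_distrib by linarith
    qed
    \<comment> \<open>Makes R times the assumed discrepancy equal to |C| + 1, which exceeds
      C.\<close>
    define R where "R = (\<bar>C\<bar> + 1) / \<bar>(\<integral>x. x ^ n \<partial>M) - s n\<bar>"
    have "R > 0" using ne by (auto simp: R_def)
    from le[OF this] have "\<bar>(\<integral>x. x ^ n \<partial>M) - s n\<bar> * R \<le> C"
      using \<open>R > 0\<close> by (simp add: field_simps)
    thus False using ne by (simp add: R_def)
  qed
  with int M.real_distribution_axioms show thesis using that by blast
qed

text \<open>Gauss rules, normalized to total mass 1, match every initial stretch of the moments;
  their limit measure is rescaled by c.\<close>

theorem hamburger_moment_problem:
  assumes L: "\<And>k. moment_functional s (s_poly \<alpha> k) = (if k = 0 then c else 0)"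
    and "c \<ge> 0" and \<alpha>: "\<And>k. k \<ge> 1 \<Longrightarrow> \<alpha> k \<ge> 0"
  obtains M :: "real measure" where "sets M = sets borel"
    "\<And>n. integrable M (\<lambda>x. x ^ n)" "\<And>n. (\<integral>x. x ^ n \<partial>M) = s n"
proof (cases "c = 0")
  case True
  \<comment> \<open>For c = 0 the functional vanishes on the basis R_k, hence everywhere, and the
    null measure represents it.\<close>
  have "s n = 0" for n
  proof -
    obtain d where "monom 1 n = (\<Sum>i\<le>n. smult (d i) (s_poly \<alpha> i))"
      using s_poly_expansion[of "monom 1 n" n \<alpha>] by (auto simp: degree_monom_le)
    hence "moment_functional s (monom 1 n) = (\<Sum>i\<le>n. d i * moment_functional s (s_poly \<alpha> i))"
      by (simp only: moment_functional_sum moment_functional_smult)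
    thus ?thesis by (simp add: L True cong: if_cong)
  qed
  thus thesis
    using that[of "null_measure borel"] by (simp add: integrable_null_measure_iff)
next
  case False
  hence "c > 0" using \<open>c \<ge> 0\<close> by simp
  have s0: "s 0 = c" using L[of 0] by simp
  have "\<exists>\<nu>. real_distribution \<nu> \<and>
      (\<forall>n\<le>N. integrable \<nu> (\<lambda>x. x ^ n) \<and> (\<integral>x. x ^ n \<partial>\<nu>) = s n / c)" for N
  proof -
    obtain A w where A: "finite A" "\<And>x. x \<in> A \<Longrightarrow> w x \<ge> 0"
      and quad: "\<And>p. degree p < 2 * Suc N \<Longrightarrow> moment_functional s p = (\<Sum>x\<in>A. w x * poly p x)"
      using gauss_quadrature[OF L \<open>c > 0\<close> \<alpha>, of "Suc N"] by auto
    have moment: "(\<Sum>x\<in>A. w x * x ^ n) = s n" if "n \<le> N" for n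
      using quad[of "monom 1 n"] that degree_monom_le[of "1::real" n] by (simp add: poly_monom)
    define \<nu>' where "\<nu>' = point_measure A (\<lambda>x. ennreal (w x / c))"
    \<comment> \<open>Moves the discrete measure from the finite set of nodes to the Borel sets of
      the line.\<close>
    define \<nu> where "\<nu> = distr \<nu>' borel (\<lambda>x. x)"
    have [measurable]: "(\<lambda>x. x) \<in> \<nu>' \<rightarrow>\<^sub>M (borel :: real measure)"
      by (simp add: \<nu>'_def measurable_def sets_point_measure space_point_measure)
    have "emeasure \<nu>' (space \<nu>') = (\<Sum>x\<in>A. ennreal (w x / c))"
      by (simp add: \<nu>'_def space_point_measure emeasure_point_measure_finite A)
    also have "\<dots> = ennreal (\<Sum>x\<in>A. w x / c)"
      by (rule sum_ennreal) (use A \<open>c > 0\<close> in auto)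
    also have "(\<Sum>x\<in>A. w x / c) = 1"
      using moment[of 0] s0 \<open>c > 0\<close> by (simp flip: sum_divide_distrib)
    finally interpret \<nu>': prob_space \<nu>' by (intro prob_spaceI) simp
    have "prob_space \<nu>" unfolding \<nu>_def by (rule \<nu>'.prob_space_distr) measurable
    hence "real_distribution \<nu>"
      by (simp add: real_distribution_def real_distribution_axioms_def \<nu>_def)
    moreover have "integrable \<nu> (\<lambda>x. x ^ n)" for n
      unfolding \<nu>_def
      by (subst integrable_distr_eq)
         (auto simp: \<nu>'_def integrable_point_measure_finite A)
    moreover have "(\<integral>x. x ^ n \<partial>\<nu>) = s n / c" if "n \<le> N" for n
    proof -
      have "(\<integral>x. x ^ n \<partial>\<nu>) = (\<integral>x. x ^ n \<partial>\<nu>')"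
        unfolding \<nu>_def by (subst integral_distr) auto
      also have "\<dots> = (\<Sum>x\<in>A. (w x / c) *\<^sub>R x ^ n)"
        unfolding \<nu>'_def by (rule lebesgue_integral_point_measure_finite) (use A \<open>c > 0\<close> in auto)
      also have "\<dots> = s n / c"
        using moment[OF that] by (simp flip: sum_divide_distrib)
      finally show ?thesis .
    qed
    ultimately show ?thesis by blast
  qed
  from moment_problem_limit[OF this] obtain M where M: "real_distribution M"
    "\<And>n. integrable M (\<lambda>x. x ^ n)" "\<And>n. (\<integral>x. x ^ n \<partial>M) = s n / c" by blast
  interpret M: real_distribution M by fact
  show thesis
  proof (rule that[of "density M (\<lambda>_. ennreal c)"])
    show "integrable (density M (\<lambda>_. ennreal c)) (\<lambda>x. x ^ n)" for n
      using M \<open>c > 0\<close> by (subst integrable_density) auto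
    show "(\<integral>x. x ^ n \<partial>density M (\<lambda>_. ennreal c)) = s n" for n
      using M \<open>c > 0\<close> by (subst integral_density) auto
  qed auto
qed

text \<open>Points outside the support have open null neighbourhoods, and by Lindelof's theorem
  countably many of these cover the complement.\<close>

lemma AE_ge_of_measure_support:
  fixes M :: "real measure"
  assumes "sets M = sets (restrict_space borel {0..})" and "measure_support M \<subseteq> {\<xi>..}"
  shows "AE x in M. \<xi> \<le> x"
proof -
  define F where "F = {U. open U \<and> emeasure M (U \<inter> space M) = 0}"
  have sp: "space M = {0..}"
    using sets_eq_imp_space_eq[OF assms(1)] by (simp add: space_restrict_space)
  obtain F' where F': "F' \<subseteq> F" "countable F'" "\<Union>F' = \<Union>F"
    using Lindelof[of F] by (auto simp: F_def)
  have "(\<Union>U\<in>F'. U \<inter> space M) \<in> null_sets M"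
  proof (rule null_sets_UN')
    fix U assume "U \<in> F'"
    hence "open U" "emeasure M (U \<inter> space M) = 0" using F' by (auto simp: F_def)
    moreover have "U \<inter> space M \<in> sets M"
      using \<open>open U\<close> unfolding assms(1) sp by (auto simp: sets_restrict_space)
    ultimately show "U \<inter> space M \<in> null_sets M" by blast
  qed (use F' in auto)
  moreover have "{x \<in> space M. \<not> \<xi> \<le> x} \<subseteq> (\<Union>U\<in>F'. U \<inter> space M)"
  proof
    fix x assume x: "x \<in> {x \<in> space M. \<not> \<xi> \<le> x}"
    hence "x \<notin> measure_support M" using assms(2) by auto
    then obtain U where "open U" "x \<in> U" "emeasure M (U \<inter> space M) = 0"
      using x by (auto simp: measure_support_def)
    hence "x \<in> \<Union>F" by (auto simp: F_def)
    thus "x \<in> (\<Union>U\<in>F'. U \<inter> space M)" using x F' by auto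
  qed
  ultimately show ?thesis by (rule AE_I')
qed

section \<open>Translation by \<open>\<xi>\<close> and the parameters \<open>g\<close>\<close>

lemma moment_functional_eq_integral:
  assumes "\<And>n. integrable M (\<lambda>x. u x ^ n)" and "\<And>n. (\<integral>x. u x ^ n \<partial>M) = s n"
  shows "integrable M (\<lambda>x. poly p (u x :: real))" and "moment_functional s p = (\<integral>x. poly p (u x) \<partial>M)"
  using assms by (simp_all add: poly_altdef moment_functional_def)

text \<open>Under x -> x - \<xi> the measure lives on the half-line. Symmetrizing its square root
  gives a functional that is nonnegative on squares, to which orthogonalization applies.\<close>

lemma xi_Stieltjes_imp_cfrac:
  assumes "xi_Stieltjes_moment_sequence \<xi> a"
  obtains \<alpha> where "a 0 \<ge> 0" "\<And>k. \<alpha> k \<ge> 0" "\<And>k. k \<ge> 1 \<Longrightarrow> \<alpha> k = 0 \<Longrightarrow> \<alpha> (Suc k) = 0"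
    "has_cfrac_expansion (Abs_fps (\<lambda>n. moment_functional a ([:-\<xi>, 1:] ^ n))) (a 0) \<alpha>"
proof -
  from assms obtain M where M: "Stieltjes_representing_measure M a"
    and supp: "measure_support M \<subseteq> {\<xi>..}"
    by (auto simp: xi_Stieltjes_moment_sequence_def)
  have sets: "sets M = sets (restrict_space borel {0..})"
    and int: "\<And>n. integrable M (\<lambda>x. x ^ n)" and mom: "\<And>n. (\<integral>x. x ^ n \<partial>M) = a n"
    using M by (auto simp: Stieltjes_representing_measure_def)
  note AE = AE_ge_of_measure_support[OF sets supp]
  have [measurable]: "(\<lambda>x. x) \<in> borel_measurable M"
    using borel_measurable_integrable[OF int[of 1]] by simp
  define b where "b n = moment_functional a ([:-\<xi>, 1:] ^ n)" for n
  have b: "integrable M (\<lambda>x. (x - \<xi>) ^ n)" "b n = (\<integral>x. (x - \<xi>) ^ n \<partial>M)" for n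
    using moment_functional_eq_integral[OF int mom, of "[:-\<xi>, 1:] ^ n"] by (simp_all add: b_def)
  \<comment> \<open>The n-th power averaged over both square roots of x - \<xi>; its integrals are
    the moments of the symmetrized measure, which need not be constructed.\<close>
  define I where "I n x = (sqrt (x - \<xi>) ^ n + (- sqrt (x - \<xi>)) ^ n) / 2" for n x
  have I_meas [measurable]: "I n \<in> borel_measurable M" for n
    unfolding I_def by measurable
  have I: "has_bochner_integral M (I n) (symmetrization b n)" for n
  proof (cases "even n")
    case True
    then obtain m where m: "n = 2 * m" by (auto elim: evenE)
    \<comment> \<open>Squaring undoes the square root where \<xi> \<le> x, which the support
      condition gives almost everywhere.\<close>
    have "AE x in M. (x - \<xi>) ^ m = I n x"
      using AE by eventually_elim (simp add: I_def m power_mult)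
    moreover have "has_bochner_integral M (\<lambda>x. (x - \<xi>) ^ m) (b m)"
      using b by (simp add: has_bochner_integral_iff)
    ultimately have "has_bochner_integral M (I n) (b m)"
      by (subst has_bochner_integral_cong_AE[symmetric]) auto
    thus ?thesis by (simp add: m symmetrization_def)
  next
    case False
    hence "I n = (\<lambda>_. 0)" by (simp add: I_def fun_eq_iff)
    thus ?thesis using False by (simp add: symmetrization_def has_bochner_integral_zero)
  qed
  have sym: "moment_functional (symmetrization b) p =
      (\<integral>x. (poly p (sqrt (x - \<xi>)) + poly p (- sqrt (x - \<xi>))) / 2 \<partial>M)" for p
  proof -
    have eq: "(poly p (sqrt (x - \<xi>)) + poly p (- sqrt (x - \<xi>))) / 2 =
        (\<Sum>i\<le>degree p. coeff p i * I i x)" for x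
      by (simp add: poly_altdef I_def sum.distrib[symmetric] sum_divide_distrib ring_distribs add_divide_distrib)
    show ?thesis
      unfolding eq using I by (simp add: has_bochner_integral_iff moment_functional_def)
  qed
  have pos: "moment_functional (symmetrization b) (p * p) \<ge> 0" for p
    unfolding sym by (rule integral_nonneg_AE) simp
  have odd: "symmetrization b n = 0" if "odd n" for n
    using that by (simp add: symmetrization_def)
  obtain \<alpha> where \<alpha>: "\<And>k. \<alpha> k \<ge> 0" "\<And>k. k \<ge> 1 \<Longrightarrow> \<alpha> k = 0 \<Longrightarrow> \<alpha> (Suc k) = 0"
    "\<And>k. k \<ge> 1 \<Longrightarrow> moment_functional (symmetrization b) (s_poly \<alpha> k) = 0"
    using ex_orthogonal_s_poly[OF pos odd] by blast
  have b0: "b 0 = a 0" by (simp add: b_def)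
  have "a 0 \<ge> 0"
    using pos[of 1] b0 by (simp add: symmetrization_def)
  moreover have "has_cfrac_expansion (Abs_fps b) (a 0) \<alpha>"
    unfolding has_cfrac_expansion_iff_s_poly using \<alpha>(3) b0 by (auto simp: symmetrization_def)
  ultimately show thesis
    using that \<alpha>(1,2) unfolding b_def by blast
qed

text \<open>A measure on the line with the symmetrized translated moments is pushed forward under y
  -> \<xi> + y^2, whose values are at least \<xi>.\<close>

lemma cfrac_imp_xi_Stieltjes:
  assumes "\<xi> \<ge> 0" "c \<ge> 0" and \<alpha>: "\<And>k. k \<ge> 1 \<Longrightarrow> \<alpha> k \<ge> 0"
    and cf: "has_cfrac_expansion (Abs_fps (\<lambda>n. moment_functional a ([:-\<xi>, 1:] ^ n))) c \<alpha>"
  shows "xi_Stieltjes_moment_sequence \<xi> a"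
proof -
  define b where "b n = moment_functional a ([:-\<xi>, 1:] ^ n)" for n
  \<comment> \<open>The expansion gives the conditions of even index; those of odd index hold by
    parity.\<close>
  have L: "moment_functional (symmetrization b) (s_poly \<alpha> k) = (if k = 0 then c else 0)" for k
  proof (cases "even k")
    case True
    then obtain m where "k = 2 * m" by (auto elim: evenE)
    thus ?thesis using cf by (simp add: has_cfrac_expansion_iff_s_poly b_def[abs_def])
  next
    case False
    hence "moment_functional (symmetrization b) (s_poly \<alpha> k) = 0"
      by (intro moment_functional_s_poly_odd) (simp_all add: symmetrization_def)
    thus ?thesis using False by (cases k) auto
  qed
  obtain M :: "real measure" where M: "sets M = sets borel" "\<And>n. integrable M (\<lambda>x. x ^ n)"
    "\<And>n. (\<integral>x. x ^ n \<partial>M) = symmetrization b n"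
    using hamburger_moment_problem[OF L \<open>c \<ge> 0\<close> \<alpha>] by blast
  note [measurable_cong] = M(1)
  \<comment> \<open>The polynomial (\<xi> + y^2)^n, whose value recovers \<open>a n\<close> because
    adding \<xi> undoes the translation.\<close>
  define q where "q n = pcompose ([:\<xi>, 1:] ^ n) [:0, 0, 1:]" for n
  have poly_q: "poly (q n) y = (\<xi> + y\<^sup>2) ^ n" for n y
    by (simp add: q_def poly_pcompose power2_eq_square)
  have a: "a n = moment_functional (symmetrization b) (q n)" for n
  proof -
    have "pcompose ([:\<xi>, 1:] ^ n) [:-\<xi>, 1:] = monom 1 n"
      by (rule poly_ext) (simp add: poly_pcompose poly_monom)
    hence "a n = moment_functional a (pcompose ([:\<xi>, 1:] ^ n) [:-\<xi>, 1:])"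
      by simp
    also have "\<dots> = moment_functional b ([:\<xi>, 1:] ^ n)"
      by (simp add: moment_functional_pcompose b_def[abs_def])
    finally show ?thesis
      by (simp add: q_def moment_functional_symmetrization_square)
  qed
  define f where "f y = \<xi> + y\<^sup>2" for y
  have [measurable]: "f \<in> borel_measurable M"
    unfolding f_def by measurable
  have f [measurable]: "f \<in> M \<rightarrow>\<^sub>M restrict_space borel {0..}"
    by (rule measurable_restrict_space2) (use \<open>\<xi> \<ge> 0\<close> in \<open>auto simp: f_def\<close>)
  have pow: "(\<lambda>x. x ^ n) \<in> borel_measurable (restrict_space borel {0::real..})" for n
    by (rule measurable_restrict_space1) measurable
  define N where "N = distr M (restrict_space borel {0..}) f"
  have "integrable M (\<lambda>y. f y ^ n)" "a n = (\<integral>y. f y ^ n \<partial>M)" for n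
    using moment_functional_eq_integral[OF M(2,3), of "q n"] by (simp_all add: a poly_q f_def)
  hence "Stieltjes_representing_measure N a"
    unfolding Stieltjes_representing_measure_def N_def
    by (simp add: integrable_distr_eq[OF f pow] integral_distr[OF f pow])
  moreover have "measure_support N \<subseteq> {\<xi>..}"
  proof
    fix x assume x: "x \<in> measure_support N"
    show "x \<in> {\<xi>..}"
    proof (rule ccontr)
      assume "x \<notin> {\<xi>..}"
      with x have "emeasure N ({..<\<xi>} \<inter> space N) > 0"
        unfolding measure_support_def by auto
      moreover have "{..<\<xi>} \<inter> space N \<in> sets N"
        by (auto simp: N_def sets_restrict_space space_restrict_space)
      hence "emeasure N ({..<\<xi>} \<inter> space N) = emeasure M (f -` ({..<\<xi>} \<inter> space N) \<inter> space M)"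
        unfolding N_def by (subst emeasure_distr) (auto simp: f)
      moreover have "f -` ({..<\<xi>} \<inter> space N) \<inter> space M = {}"
        by (auto simp: f_def not_less)
      ultimately show False by simp
    qed
  qed
  ultimately show ?thesis
    unfolding xi_Stieltjes_moment_sequence_def by blast
qed

section \<open>The parameters g and the coefficients \<alpha>\<close>

text \<open>Written exactly as in the theorem, so that both occurrences there can be folded;
  \<open>xi_coeffs_iff\<close> is the form without index subtraction.\<close>

definition xi_coeffs :: "real \<Rightarrow> (nat \<Rightarrow> real) \<Rightarrow> (nat \<Rightarrow> real) \<Rightarrow> bool" where
  "xi_coeffs \<xi> g \<alpha> \<longleftrightarrow> (\<forall>k\<ge>1. \<alpha> (2*k - 1) = \<xi> * (1 + g (2*k - 2)) + g (2*k - 1) \<and>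
                      \<alpha> (2*k) = g (2*k - 1) * g (2*k) / (1 + g (2*k - 2)))"

lemma xi_coeffs_iff:
  "xi_coeffs \<xi> g \<alpha> \<longleftrightarrow> (\<forall>k. \<alpha> (2*k + 1) = \<xi> * (1 + g (2*k)) + g (2*k + 1) \<and>
                      \<alpha> (2*k + 2) = g (2*k + 1) * g (2*k + 2) / (1 + g (2*k)))"
proof -
  have *: "(\<forall>k\<ge>1. P k) \<longleftrightarrow> (\<forall>k. P (Suc k))" for P :: "nat \<Rightarrow> bool"
    by (metis One_nat_def Suc_le_D Suc_le_mono le0)
  show ?thesis
    unfolding xi_coeffs_def * by simp
qed

text \<open>
  Both fractions contract to J-fractions; the coefficients \<open>\<alpha>'\<close> are those for which the
  two J-fractions differ by the translation by \<open>\<xi>\<close>.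
\<close>

lemma xi_coeffs_cfrac_shift:
  assumes "xi_coeffs \<xi> g \<alpha>" and "g 0 = 0" and g: "\<And>k. g k \<ge> 0"
    and \<alpha>': "\<And>k. \<alpha>' (2*k + 1) = g (2*k + 1)"
      "\<And>k. \<alpha>' (2*k + 2) = g (2*k + 2) * (\<xi> + g (2*k + 1) / (1 + g (2*k)))"
  shows "has_cfrac_expansion (Abs_fps a) c \<alpha> \<longleftrightarrow>
           has_cfrac_expansion (Abs_fps (\<lambda>n. moment_functional a ([:-\<xi>, 1:] ^ n))) c \<alpha>'"
proof (rule has_cfrac_expansion_shift)
  have \<alpha>: "\<alpha> (2*k + 1) = \<xi> * (1 + g (2*k)) + g (2*k + 1)"
    "\<alpha> (2*k + 2) = g (2*k + 1) * g (2*k + 2) / (1 + g (2*k))" for k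
    using assms(1) by (auto simp: xi_coeffs_iff)
  have nz: "1 + g k \<noteq> 0" for k using g[of k] by linarith
  show "\<alpha> 1 = \<alpha>' 1 + \<xi>"
    using \<alpha>(1)[of 0] \<alpha>'(1)[of 0] \<open>g 0 = 0\<close> by simp
  fix k :: nat assume "k \<ge> 1"
  then obtain j where k: "k = Suc j" by (cases k) auto
  have 1: "\<alpha> (2*k) = g (2*k - 1) * g (2*k) / (1 + g (2*j))" "\<alpha> (2*k - 1) = \<xi> * (1 + g (2*j)) + g (2*k - 1)"
    "\<alpha>' (2*k) = g (2*k) * (\<xi> + g (2*k - 1) / (1 + g (2*j)))" "\<alpha>' (2*k - 1) = g (2*k - 1)"
    using \<alpha>[of j] \<alpha>'[of j] by (simp_all add: k)
  show "\<alpha> (2*k) + \<alpha> (2*k + 1) = \<alpha>' (2*k) + \<alpha>' (2*k + 1) + \<xi>"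
    unfolding 1 \<alpha>(1) \<alpha>'(1) using nz[of "2*j"] by (simp add: field_simps)
  show "\<alpha> (2*k - 1) * \<alpha> (2*k) = \<alpha>' (2*k - 1) * \<alpha>' (2*k)"
    unfolding 1 using nz[of "2*j"] by (simp add: field_simps)
qed

text \<open>Odd parameters are copied, even ones found recursively by division. A denominator
  vanishes only if \<xi> = 0 and the preceding coefficient is 0; then the next coefficient is 0 by
  \<open>zero\<close>, and the default value solves the equation.\<close>

lemma ex_xi_coeffs_of_shifted:
  fixes \<xi> :: real and \<alpha>' :: "nat \<Rightarrow> real"
  assumes "\<xi> \<ge> 0" and nonneg: "\<And>k. \<alpha>' k \<ge> 0"
    and zero: "\<And>k. k \<ge> 1 \<Longrightarrow> \<alpha>' k = 0 \<Longrightarrow> \<alpha>' (Suc k) = 0"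
  obtains g where "g 0 = 0" "\<And>k. g k \<ge> 0" "\<And>k. \<alpha>' (2*k + 1) = g (2*k + 1)"
    "\<And>k. \<alpha>' (2*k + 2) = g (2*k + 2) * (\<xi> + g (2*k + 1) / (1 + g (2*k)))"
proof -
  \<comment> \<open>\<open>e k\<close> is the parameter of index 2k.\<close>
  define e where "e = rec_nat 0 (\<lambda>k x. \<alpha>' (2*k + 2) / (\<xi> + \<alpha>' (2*k + 1) / (1 + x)))"
  have e: "e 0 = 0" "e (Suc k) = \<alpha>' (2*k + 2) / (\<xi> + \<alpha>' (2*k + 1) / (1 + e k))" for k
    by (simp_all add: e_def)
  have e_nonneg: "e k \<ge> 0" for k
    by (induction k) (auto simp: e intro!: divide_nonneg_nonneg add_nonneg_nonneg nonneg \<open>\<xi> \<ge> 0\<close>)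
  define g where "g n = (if even n then e (n div 2) else \<alpha>' n)" for n
  show thesis
  proof (rule that[of g])
    show "\<alpha>' (2*k + 2) = g (2*k + 2) * (\<xi> + g (2*k + 1) / (1 + g (2*k)))" for k
    proof (cases "\<xi> + \<alpha>' (2*k + 1) / (1 + e k) = 0")
      case True
      have "\<alpha>' (2*k + 1) / (1 + e k) \<ge> 0"
        using nonneg[of "2*k + 1"] e_nonneg[of k] by simp
      with True \<open>\<xi> \<ge> 0\<close> have "\<alpha>' (2*k + 1) / (1 + e k) = 0" by linarith
      hence "\<alpha>' (2*k + 1) = 0" using e_nonneg[of k] by auto
      hence "\<alpha>' (2*k + 2) = 0" using zero[of "2*k + 1"] by simp
      thus ?thesis using True by (simp add: g_def)
    next
      case False
      thus ?thesis by (simp add: g_def e)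
    qed
  qed (auto simp: g_def e e_nonneg nonneg)
qed

text \<open>
  Lowering \<open>g\<^sub>0\<close> to zero with the coefficients \<open>\<alpha>\<close> fixed lowers every even and raises every odd
  parameter.
\<close>

lemma xi_coeffs_normalize:
  assumes "\<xi> \<ge> 0" and "xi_coeffs \<xi> g \<alpha>" and g: "\<And>k. g k \<ge> 0"
  obtains g' where "xi_coeffs \<xi> g' \<alpha>" "g' 0 = 0" "\<And>k. g' k \<ge> 0"
proof -
  have \<alpha>: "\<alpha> (2*k + 1) = \<xi> * (1 + g (2*k)) + g (2*k + 1)"
    "\<alpha> (2*k + 2) = g (2*k + 1) * g (2*k + 2) / (1 + g (2*k))" for k
    using assms(2) by (auto simp: xi_coeffs_iff)
  \<comment> \<open>\<open>e k\<close> and \<open>d k\<close> are the new parameters of index 2k and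
    2k + 1, obtained by solving the two coefficient equations in turn from
    \<open>e 0 = 0\<close>.\<close>
  define e where "e = rec_nat 0 (\<lambda>k x. \<alpha> (2*k + 2) * (1 + x) / (\<alpha> (2*k + 1) - \<xi> * (1 + x)))"
  define d where "d k = \<alpha> (2*k + 1) - \<xi> * (1 + e k)" for k
  have e: "e 0 = 0" "e (Suc k) = \<alpha> (2*k + 2) * (1 + e k) / d k" for k
    by (simp_all add: e_def d_def)
  have d_ge: "d k \<ge> g (2*k + 1)" if "e k \<le> g (2*k)" for k
    using mult_left_mono[OF that \<open>\<xi> \<ge> 0\<close>] unfolding d_def \<alpha>(1) by (simp add: algebra_simps)
  \<comment> \<open>As long as the new even parameter is not above the old one, the new odd
    parameter is not below the old one, hence nonnegative, and the bound carries over to the next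
    even parameter.\<close>
  have e_bounds: "0 \<le> e k \<and> e k \<le> g (2*k)" for k
  proof (induction k)
    case (Suc k)
    with d_ge have d: "d k \<ge> g (2*k + 1)" by blast
    have "\<alpha> (2*k + 2) \<ge> 0"
      unfolding \<alpha>(2) by (intro divide_nonneg_nonneg mult_nonneg_nonneg add_nonneg_nonneg g) simp
    moreover have d0: "d k \<ge> 0" using d g[of "2*k + 1"] by linarith
    ultimately have "e (Suc k) \<ge> 0" using Suc by (simp add: e)
    moreover have "e (Suc k) \<le> g (2*k + 2)"
    proof (cases "d k = 0")
      case True
      thus ?thesis using g by (simp add: e)
    next
      case False
      have "\<alpha> (2*k + 2) * (1 + e k) = g (2*k + 2) * (g (2*k + 1) * ((1 + e k) / (1 + g (2*k))))"
        unfolding \<alpha>(2) by simp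
      also have "\<dots> \<le> g (2*k + 2) * (d k * 1)"
        using Suc d d0 g[of "2*k"] by (intro mult_left_mono mult_mono g) auto
      finally show ?thesis using False d0 by (simp add: e field_simps)
    qed
    ultimately show ?case by simp
  qed (auto simp: e g)
  have d_nonneg: "d k \<ge> g (2*k + 1)" for k using e_bounds d_ge by blast
  define g' where "g' n = (if even n then e (n div 2) else d (n div 2))" for n
  show thesis
  proof (rule that[of g'])
    show "xi_coeffs \<xi> g' \<alpha>"
      unfolding xi_coeffs_iff
    proof (intro allI conjI)
      fix k
      show "\<alpha> (2*k + 1) = \<xi> * (1 + g' (2*k)) + g' (2*k + 1)"
        by (simp add: g'_def d_def)
      show "\<alpha> (2*k + 2) = g' (2*k + 1) * g' (2*k + 2) / (1 + g' (2*k))"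
      proof (cases "d k = 0")
        \<comment> \<open>The old odd parameter vanishes here as well, so the coefficient is 0 and
          both sides agree.\<close>
        case True
        hence "g (2*k + 1) = 0" using d_nonneg[of k] g[of "2*k + 1"] by simp
        thus ?thesis using True unfolding \<alpha>(2) by (simp add: g'_def)
      next
        case False
        have "1 + e k \<noteq> 0" using e_bounds[of k] by linarith
        thus ?thesis using False by (simp add: g'_def e)
      qed
    qed
    show "g' 0 = 0" by (simp add: g'_def e)
    show "g' k \<ge> 0" for k
      using e_bounds[of "k div 2"] d_nonneg[of "k div 2"] g[of "2 * (k div 2) + 1"]
      by (auto simp: g'_def)
  qed
qed

lemma xi_coeffs_of_g: "\<exists>\<alpha>. xi_coeffs \<xi> g \<alpha>"
  unfolding xi_coeffs_iff
  by (rule exI[of _ "\<lambda>n. if odd n then \<xi> * (1 + g (n - 1)) + g n else g (n - 1) * g n / (1 + g (n - 2))"])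
     simp

lemma xi_Stieltjes_imp_xi_coeffs:
  assumes "\<xi> \<ge> 0" and "xi_Stieltjes_moment_sequence \<xi> a"
  obtains c g \<alpha> where "c \<ge> 0" "g 0 = 0" "\<And>k. g k \<ge> 0" "xi_coeffs \<xi> g \<alpha>"
    "has_cfrac_expansion (Abs_fps a) c \<alpha>"
proof -
  obtain \<alpha>' where \<alpha>': "a 0 \<ge> 0" "\<And>k. \<alpha>' k \<ge> 0" "\<And>k. k \<ge> 1 \<Longrightarrow> \<alpha>' k = 0 \<Longrightarrow> \<alpha>' (Suc k) = 0"
    "has_cfrac_expansion (Abs_fps (\<lambda>n. moment_functional a ([:-\<xi>, 1:] ^ n))) (a 0) \<alpha>'"
    using xi_Stieltjes_imp_cfrac[OF assms(2)] by blast
  obtain g where g: "g 0 = 0" "\<And>k. g k \<ge> 0" "\<And>k. \<alpha>' (2*k + 1) = g (2*k + 1)"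
    "\<And>k. \<alpha>' (2*k + 2) = g (2*k + 2) * (\<xi> + g (2*k + 1) / (1 + g (2*k)))"
    using ex_xi_coeffs_of_shifted[of \<xi> \<alpha>', OF assms(1) \<alpha>'(2,3)] by metis
  obtain \<alpha> where \<alpha>: "xi_coeffs \<xi> g \<alpha>" using xi_coeffs_of_g by blast
  from xi_coeffs_cfrac_shift[of \<xi> g \<alpha> \<alpha>', OF \<alpha> g(1-4)] \<alpha>'(4)
  have "has_cfrac_expansion (Abs_fps a) (a 0) \<alpha>" by blast
  with \<alpha>'(1) g(1,2) \<alpha> show thesis using that by blast
qed

text \<open>The translation lemma asks for \<open>g 0 = 0\<close>, so the parameters are normalized
  first, with \<open>\<alpha>\<close> and the fraction kept.\<close>

lemma xi_coeffs_imp_xi_Stieltjes: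
  assumes "\<xi> \<ge> 0" "c \<ge> 0" and "\<And>k. g k \<ge> 0" and "xi_coeffs \<xi> g \<alpha>"
    and cf: "has_cfrac_expansion (Abs_fps a) c \<alpha>"
  shows "xi_Stieltjes_moment_sequence \<xi> a"
proof -
  obtain g' where g': "xi_coeffs \<xi> g' \<alpha>" "g' 0 = 0" "\<And>k. g' k \<ge> 0"
    using xi_coeffs_normalize[of \<xi> g \<alpha>] assms by blast
  \<comment> \<open>Coefficients of the translated S-fraction for the normalized parameters; at n =
    0 the value is 0 because \<open>g' 0 = 0\<close>.\<close>
  define \<alpha>' where "\<alpha>' n = (if odd n then g' n else g' n * (\<xi> + g' (n - 1) / (1 + g' (n - 2))))" for n
  show ?thesis
  proof (rule cfrac_imp_xi_Stieltjes[OF assms(1,2)])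
    show "has_cfrac_expansion (Abs_fps (\<lambda>n. moment_functional a ([:-\<xi>, 1:] ^ n))) c \<alpha>'"
      using xi_coeffs_cfrac_shift[of \<xi> g' \<alpha> \<alpha>' a c, OF g'] cf by (simp add: \<alpha>'_def)
    show "\<alpha>' k \<ge> 0" for k
      using assms(1) by (auto simp: \<alpha>'_def intro!: mult_nonneg_nonneg add_nonneg_nonneg divide_nonneg_nonneg g')
  qed
qed

theorem theorem2:
  fixes \<xi> :: real and a :: "nat \<Rightarrow> real"
  assumes "\<xi> \<ge> 0"
  shows "(xi_Stieltjes_moment_sequence \<xi> a \<longleftrightarrow>
           (\<exists>(c::real) (g :: nat \<Rightarrow> real) (\<alpha> :: nat \<Rightarrow> real).
              c \<ge> 0 \<and> g 0 = 0 \<and> (\<forall>k\<ge>1. g k \<ge> 0) \<and>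
              (\<forall>k\<ge>1. \<alpha> (2*k - 1) = \<xi> * (1 + g (2*k - 2)) + g (2*k - 1) \<and>
                      \<alpha> (2*k) = g (2*k - 1) * g (2*k) / (1 + g (2*k - 2))) \<and>
              has_cfrac_expansion (Abs_fps a) c \<alpha>)) \<and>
         (xi_Stieltjes_moment_sequence \<xi> a \<longleftrightarrow>
           (\<exists>(c::real) (g :: nat \<Rightarrow> real) (\<alpha> :: nat \<Rightarrow> real).
              c \<ge> 0 \<and> (\<forall>k. g k \<ge> 0) \<and>
              (\<forall>k\<ge>1. \<alpha> (2*k - 1) = \<xi> * (1 + g (2*k - 2)) + g (2*k - 1) \<and>
                      \<alpha> (2*k) = g (2*k - 1) * g (2*k) / (1 + g (2*k - 2))) \<and>
              has_cfrac_expansion (Abs_fps a) c \<alpha>))"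
  unfolding xi_coeffs_def[symmetric]
proof (intro conjI iffI)
  assume "xi_Stieltjes_moment_sequence \<xi> a"
  from xi_Stieltjes_imp_xi_coeffs[OF assms this]
  show "\<exists>c g \<alpha>. c \<ge> 0 \<and> g 0 = 0 \<and> (\<forall>k\<ge>1. g k \<ge> 0) \<and> xi_coeffs \<xi> g \<alpha> \<and>
          has_cfrac_expansion (Abs_fps a) c \<alpha>"
    and "\<exists>c g \<alpha>. c \<ge> 0 \<and> (\<forall>k. g k \<ge> 0) \<and> xi_coeffs \<xi> g \<alpha> \<and>
          has_cfrac_expansion (Abs_fps a) c \<alpha>"
    by metis+
next
  assume "\<exists>c g \<alpha>. c \<ge> 0 \<and> (\<forall>k. g k \<ge> 0) \<and> xi_coeffs \<xi> g \<alpha> \<and>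
          has_cfrac_expansion (Abs_fps a) c \<alpha>"
  thus "xi_Stieltjes_moment_sequence \<xi> a"
    using xi_coeffs_imp_xi_Stieltjes[OF assms] by blast
next
  assume "\<exists>c g \<alpha>. c \<ge> 0 \<and> g 0 = 0 \<and> (\<forall>k\<ge>1. g k \<ge> 0) \<and> xi_coeffs \<xi> g \<alpha> \<and>
          has_cfrac_expansion (Abs_fps a) c \<alpha>"
  then obtain c g \<alpha> where *: "c \<ge> 0" "g 0 = 0" "\<forall>k\<ge>1. g k \<ge> 0" "xi_coeffs \<xi> g \<alpha>"
    "has_cfrac_expansion (Abs_fps a) c \<alpha>" by blast
  have "g k \<ge> 0" for k using *(2,3) by (cases k) auto
  thus "xi_Stieltjes_moment_sequence \<xi> a"
    using xi_coeffs_imp_xi_Stieltjes[OF assms] * by blast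
qed

end
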